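(* Let $\Gamma=(F,G,\eta,\rho)$ be a right wide Morita context between the Grothendieck categories $\mathcal A$ and $\mathcal B$ (so $F:\mathcal B\to\mathcal A$, $G:\mathcal A\to\mathcal B$), such that the functors $F$ and $G$ have right adjoints $F':\mathcal A\to\mathcal B$ and $G':\mathcal B\to\mathcal A$. Let $\mathcal C_\Gamma\subseteq\mathcal A$ and $\mathcal D_\Gamma\subseteq\mathcal B$ be the subcategories defined by $\eta$ and $\rho$ respectively. Then the quotient categories $\mathcal A/\overline{\mathcal C_\Gamma}$ and $\mathcal B/\overline{\mathcal D_\Gamma}$ are equivalent via the functors $F'$ and $G'$.
   Context: All functors are additive; subcategory means full subcategory. A right wide Morita context between abelian categories $\mathcal A$ and $\mathcal B$ is a datum $(F,G,\eta,\rho)$ where $F:\mathcal B\to\mathcal A$ and $G:\mathcal A\to\mathcal B$ are right exact functors and $\eta:F\circ G\to 1_{\mathcal A}$, $\rho:G\circ F\to 1_{\mathcal B}$ are natural transformations with $G\eta=\rho G$ and $F\rho=\eta F$. $\mathcal C_\Gamma=\{X\in\mathcal A \mid f\circ\eta(M)=0 \text{ for every } M\in\mathcal A \text{ and every } f:M\to X\}$, and similarly $\mathcal D_\Gamma=\{Y\in\mathcal B\mid f\circ\rho(N)=0 \text{ for every } N\in\mathcal B\text{ and every } f:N\to Y\}$. A subcategory of a Grothendieck category is closed if it is closed under subobjects, factor objects and arbitrary direct sums; it is localizing if moreover it is closed under extensions. For a closed subcategory $\mathcal C$, $\overline{\mathcal C}$ denotes the smallest localizing subcategory containing $\mathcal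 C$. (Here $\mathcal C_\Gamma$ and $\mathcal D_\Gamma$ are closed subcategories.) For a localizing subcategory $\mathcal L$ of $\mathcal A$, the quotient category $\mathcal A/\mathcal L$ is identified, as usual, with the full subcategory of $\mathcal L$-closed objects of $\mathcal A$, i.e. objects $M$ such that (torsion free) no nonzero object of $\mathcal L$ embeds in $M$, and ($\mathcal L$-injective) for every monomorphism $i:X'\to X$ with $X/X'\in\mathcal L$ every $f:X'\to M$ extends along $i$ to $X\to M$. "Via the functors $F'$ and $G'$" refers to their restrictions to the subcategories of closed objects. *)

theory Defs
  imports "HOL-Algebra.Group"
begin

unbundle cardinal_syntax

section \<open>Preadditive and abelian categories\<close>

text \<open>
  A category has a set of objects and a set of arrows. Composition is written in the usual
  order, so that \<open>g \<cdot> f\<close> is defined when \<open>Cod f = Dom g\<close>, and every axiom is relativised to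
  composable arrows. \<open>Plus\<close> and \<open>Zero X Y\<close> are the addition and the zero of the group of
  arrows from \<open>X\<close> to \<open>Y\<close>.
\<close>

record ('o, 'm) precat =
  Obj :: "'o set"
  Arr :: "'m set"
  Dom :: "'m \<Rightarrow> 'o"
  Cod :: "'m \<Rightarrow> 'o"
  Id :: "'o \<Rightarrow> 'm"
  Comp :: "'m \<Rightarrow> 'm \<Rightarrow> 'm" (infixr "\<cdot>\<index>" 70)
  Plus :: "'m \<Rightarrow> 'm \<Rightarrow> 'm"
  Zero :: "'o \<Rightarrow> 'o \<Rightarrow> 'm"

definition Hom :: "('o, 'm) precat \<Rightarrow> 'o \<Rightarrow> 'o \<Rightarrow> 'm set" where
  "Hom C X Y = {f \<in> Arr C. Dom C f = X \<and> Cod C f = Y}"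

locale category =
  fixes C :: "('o, 'm) precat" (structure)
  assumes Dom_Obj: "f \<in> Arr C \<Longrightarrow> Dom C f \<in> Obj C"
    and Cod_Obj: "f \<in> Arr C \<Longrightarrow> Cod C f \<in> Obj C"
    and Id_Hom: "X \<in> Obj C \<Longrightarrow> Id C X \<in> Hom C X X"
    and Comp_Hom: "\<lbrakk>f \<in> Hom C X Y; g \<in> Hom C Y Z\<rbrakk> \<Longrightarrow> g \<cdot> f \<in> Hom C X Z"
    and Comp_assoc: "\<lbrakk>f \<in> Hom C W X; g \<in> Hom C X Y; h \<in> Hom C Y Z\<rbrakk>
      \<Longrightarrow> (h \<cdot> g) \<cdot> f = h \<cdot> (g \<cdot> f)"
    and Comp_Id: "f \<in> Hom C X Y \<Longrightarrow> f \<cdot> Id C X = f"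
    and Id_Comp: "f \<in> Hom C X Y \<Longrightarrow> Id C Y \<cdot> f = f"

definition hom_group :: "('o, 'm) precat \<Rightarrow> 'o \<Rightarrow> 'o \<Rightarrow> 'm monoid" where
  "hom_group C X Y = \<lparr>carrier = Hom C X Y, mult = Plus C, one = Zero C X Y\<rparr>"

locale preadditive_category = category +
  assumes hom_comm_group: "\<lbrakk>X \<in> Obj C; Y \<in> Obj C\<rbrakk> \<Longrightarrow> comm_group (hom_group C X Y)"
    and Comp_Plus_right: "\<lbrakk>f \<in> Hom C X Y; f' \<in> Hom C X Y; g \<in> Hom C Y Z\<rbrakk>
      \<Longrightarrow> g \<cdot> Plus C f f' = Plus C (g \<cdot> f) (g \<cdot> f')"
    and Comp_Plus_left: "\<lbrakk>f \<in> Hom C X Y; g \<in> Hom C Y Z; g' \<in> Hom C Y Z\<rbrakk>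
      \<Longrightarrow> Plus C g g' \<cdot> f = Plus C (g \<cdot> f) (g' \<cdot> f)"

definition mono_arr :: "('o, 'm) precat \<Rightarrow> 'm \<Rightarrow> bool" where
  "mono_arr C m \<longleftrightarrow> m \<in> Arr C \<and>
    (\<forall>W. \<forall>f \<in> Hom C W (Dom C m). \<forall>g \<in> Hom C W (Dom C m). m \<cdot>\<^bsub>C\<^esub> f = m \<cdot>\<^bsub>C\<^esub> g \<longrightarrow> f = g)"

definition epi_arr :: "('o, 'm) precat \<Rightarrow> 'm \<Rightarrow> bool" where
  "epi_arr C e \<longleftrightarrow> e \<in> Arr C \<and>
    (\<forall>Z. \<forall>f \<in> Hom C (Cod C e) Z. \<forall>g \<in> Hom C (Cod C e) Z. f \<cdot>\<^bsub>C\<^esub> e = g \<cdot>\<^bsub>C\<^esub> e \<longrightarrow> f = g)"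

definition iso_arr :: "('o, 'm) precat \<Rightarrow> 'm \<Rightarrow> bool" where
  "iso_arr C f \<longleftrightarrow> f \<in> Arr C \<and>
    (\<exists>g \<in> Hom C (Cod C f) (Dom C f). g \<cdot>\<^bsub>C\<^esub> f = Id C (Dom C f) \<and> f \<cdot>\<^bsub>C\<^esub> g = Id C (Cod C f))"

definition zero_object :: "('o, 'm) precat \<Rightarrow> 'o \<Rightarrow> bool" where
  "zero_object C Z \<longleftrightarrow> Z \<in> Obj C \<and>
    (\<forall>X \<in> Obj C. (\<exists>!f. f \<in> Hom C X Z) \<and> (\<exists>!f. f \<in> Hom C Z X))"

definition biproduct ::
  "('o, 'm) precat \<Rightarrow> 'o \<Rightarrow> 'o \<Rightarrow> 'o \<Rightarrow> 'm \<Rightarrow> 'm \<Rightarrow> 'm \<Rightarrow> 'm \<Rightarrow> bool" where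
  "biproduct C X Y S i j p q \<longleftrightarrow>
    i \<in> Hom C X S \<and> j \<in> Hom C Y S \<and> p \<in> Hom C S X \<and> q \<in> Hom C S Y \<and>
    p \<cdot>\<^bsub>C\<^esub> i = Id C X \<and> q \<cdot>\<^bsub>C\<^esub> j = Id C Y \<and> p \<cdot>\<^bsub>C\<^esub> j = Zero C Y X \<and> q \<cdot>\<^bsub>C\<^esub> i = Zero C X Y \<and>
    Plus C (i \<cdot>\<^bsub>C\<^esub> p) (j \<cdot>\<^bsub>C\<^esub> q) = Id C S"

definition is_kernel :: "('o, 'm) precat \<Rightarrow> 'm \<Rightarrow> 'm \<Rightarrow> bool" where
  "is_kernel C f k \<longleftrightarrow> f \<in> Arr C \<and> k \<in> Arr C \<and> Cod C k = Dom C f \<and>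
    f \<cdot>\<^bsub>C\<^esub> k = Zero C (Dom C k) (Cod C f) \<and>
    (\<forall>W. \<forall>g \<in> Hom C W (Dom C f). f \<cdot>\<^bsub>C\<^esub> g = Zero C W (Cod C f) \<longrightarrow>
      (\<exists>!h. h \<in> Hom C W (Dom C k) \<and> k \<cdot>\<^bsub>C\<^esub> h = g))"

definition is_cokernel :: "('o, 'm) precat \<Rightarrow> 'm \<Rightarrow> 'm \<Rightarrow> bool" where
  "is_cokernel C f c \<longleftrightarrow> f \<in> Arr C \<and> c \<in> Arr C \<and> Dom C c = Cod C f \<and>
    c \<cdot>\<^bsub>C\<^esub> f = Zero C (Dom C f) (Cod C c) \<and>
    (\<forall>Z. \<forall>g \<in> Hom C (Cod C f) Z. g \<cdot>\<^bsub>C\<^esub> f = Zero C (Dom C f) Z \<longrightarrow>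
      (\<exists>!h. h \<in> Hom C (Cod C c) Z \<and> h \<cdot>\<^bsub>C\<^esub> c = g))"

locale abelian_category = preadditive_category +
  assumes zero_object_exists: "\<exists>Z. zero_object C Z"
    and biproduct_exists: "\<lbrakk>X \<in> Obj C; Y \<in> Obj C\<rbrakk> \<Longrightarrow> \<exists>S i j p q. biproduct C X Y S i j p q"
    and kernel_exists: "f \<in> Arr C \<Longrightarrow> \<exists>k. is_kernel C f k"
    and cokernel_exists: "f \<in> Arr C \<Longrightarrow> \<exists>c. is_cokernel C f c"
    and mono_is_kernel: "mono_arr C m \<Longrightarrow> \<exists>f. is_kernel C f m"
    and epi_is_cokernel: "epi_arr C e \<Longrightarrow> \<exists>f. is_cokernel C f e"

text \<open>\<open>exact C f g\<close>: the image of \<open>f\<close>, i.e. the kernel of a cokernel of \<open>f\<close>, is the kernel of \<open>g\<close>.\<close>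

definition exact :: "('o, 'm) precat \<Rightarrow> 'm \<Rightarrow> 'm \<Rightarrow> bool" where
  "exact C f g \<longleftrightarrow> (\<exists>c k. is_cokernel C f c \<and> is_kernel C c k \<and> is_kernel C g k)"

definition short_exact :: "('o, 'm) precat \<Rightarrow> 'm \<Rightarrow> 'm \<Rightarrow> bool" where
  "short_exact C f g \<longleftrightarrow> mono_arr C f \<and> exact C f g \<and> epi_arr C g"

section \<open>Grothendieck categories\<close>

text \<open>
  Smallness is measured by an uncountable regular cardinal \<open>\<kappa>\<close>: a set is small if its
  cardinality is less than \<open>\<kappa>\<close>. Small index sets may then be taken inside the type carrying \<open>\<kappa>\<close>.
  For \<open>\<kappa>\<close> the cardinality of a Grothendieck universe this is the usual meaning of
  ``small''. Neither is \<open>\<kappa>\<close> required to be a strong limit, since HOL does not prove that such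
  an uncountable \<open>\<kappa>\<close> exists, nor are hom-sets required to be small.
\<close>

definition smallness_cardinal :: "'k rel \<Rightarrow> bool" where
  "smallness_cardinal \<kappa> \<longleftrightarrow> Card_order \<kappa> \<and> natLeq <o \<kappa> \<and> regularCard \<kappa>"

definition small :: "'k rel \<Rightarrow> 'k set \<Rightarrow> bool" where
  "small \<kappa> I \<longleftrightarrow> |I| <o \<kappa>"

definition is_coproduct ::
  "('o, 'm) precat \<Rightarrow> 'i set \<Rightarrow> ('i \<Rightarrow> 'o) \<Rightarrow> 'o \<Rightarrow> ('i \<Rightarrow> 'm) \<Rightarrow> bool" where
  "is_coproduct C I X S inc \<longleftrightarrow> S \<in> Obj C \<and> (\<forall>i \<in> I. inc i \<in> Hom C (X i) S) \<and>
    (\<forall>T \<in> Obj C. \<forall>f. (\<forall>i \<in> I. f i \<in> Hom C (X i) T) \<longrightarrow>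
      (\<exists>!h. h \<in> Hom C S T \<and> (\<forall>i \<in> I. h \<cdot>\<^bsub>C\<^esub> inc i = f i)))"

definition directed_set :: "'i set \<Rightarrow> 'i rel \<Rightarrow> bool" where
  "directed_set I r \<longleftrightarrow> preorder_on I r \<and> I \<noteq> {} \<and>
    (\<forall>i \<in> I. \<forall>j \<in> I. \<exists>k \<in> I. (i, k) \<in> r \<and> (j, k) \<in> r)"

definition direct_system ::
  "('o, 'm) precat \<Rightarrow> 'i set \<Rightarrow> 'i rel \<Rightarrow> ('i \<Rightarrow> 'o) \<Rightarrow> ('i \<Rightarrow> 'i \<Rightarrow> 'm) \<Rightarrow> bool" where
  "direct_system C I r X t \<longleftrightarrow>
    (\<forall>i \<in> I. X i \<in> Obj C \<and> t i i = Id C (X i)) \<and>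
    (\<forall>i j. (i, j) \<in> r \<longrightarrow> t i j \<in> Hom C (X i) (X j)) \<and>
    (\<forall>i j k. (i, j) \<in> r \<and> (j, k) \<in> r \<longrightarrow> t j k \<cdot>\<^bsub>C\<^esub> t i j = t i k)"

definition system_morphism ::
  "('o, 'm) precat \<Rightarrow> 'i set \<Rightarrow> 'i rel \<Rightarrow> ('i \<Rightarrow> 'o) \<Rightarrow> ('i \<Rightarrow> 'i \<Rightarrow> 'm) \<Rightarrow>
    ('i \<Rightarrow> 'o) \<Rightarrow> ('i \<Rightarrow> 'i \<Rightarrow> 'm) \<Rightarrow> ('i \<Rightarrow> 'm) \<Rightarrow> bool" where
  "system_morphism C I r X t Y u f \<longleftrightarrow>
    (\<forall>i \<in> I. f i \<in> Hom C (X i) (Y i)) \<and>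
    (\<forall>i j. (i, j) \<in> r \<longrightarrow> f j \<cdot>\<^bsub>C\<^esub> t i j = u i j \<cdot>\<^bsub>C\<^esub> f i)"

definition is_cocone ::
  "('o, 'm) precat \<Rightarrow> 'i set \<Rightarrow> 'i rel \<Rightarrow> ('i \<Rightarrow> 'o) \<Rightarrow> ('i \<Rightarrow> 'i \<Rightarrow> 'm) \<Rightarrow> 'o \<Rightarrow> ('i \<Rightarrow> 'm) \<Rightarrow> bool" where
  "is_cocone C I r X t L l \<longleftrightarrow> L \<in> Obj C \<and> (\<forall>i \<in> I. l i \<in> Hom C (X i) L) \<and>
    (\<forall>i j. (i, j) \<in> r \<longrightarrow> l j \<cdot>\<^bsub>C\<^esub> t i j = l i)"

definition is_direct_limit ::
  "('o, 'm) precat \<Rightarrow> 'i set \<Rightarrow> 'i rel \<Rightarrow> ('i \<Rightarrow> 'o) \<Rightarrow> ('i \<Rightarrow> 'i \<Rightarrow> 'm) \<Rightarrow> 'o \<Rightarrow> ('i \<Rightarrow> 'm) \<Rightarrow> bool" where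
  "is_direct_limit C I r X t L l \<longleftrightarrow> is_cocone C I r X t L l \<and>
    (\<forall>T f. is_cocone C I r X t T f \<longrightarrow>
      (\<exists>!h. h \<in> Hom C L T \<and> (\<forall>i \<in> I. h \<cdot>\<^bsub>C\<^esub> l i = f i)))"

definition is_generator :: "('o, 'm) precat \<Rightarrow> 'o \<Rightarrow> bool" where
  "is_generator C U \<longleftrightarrow> U \<in> Obj C \<and>
    (\<forall>X Y. \<forall>f \<in> Hom C X Y. \<forall>g \<in> Hom C X Y. f \<noteq> g \<longrightarrow> (\<exists>h \<in> Hom C U X. f \<cdot>\<^bsub>C\<^esub> h \<noteq> g \<cdot>\<^bsub>C\<^esub> h))"

text \<open>
  In \<open>direct_limits_exact\<close>, \<open>f'\<close> and \<open>g'\<close> are the arrows induced by \<open>f\<close> and \<open>g\<close> on the limits.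
\<close>

locale grothendieck_category = abelian_category C
  for \<kappa> :: "'k rel" and C :: "('o, 'm) precat" (structure) +
  assumes coproduct_exists: "\<And>(I :: 'k set) X. \<lbrakk>small \<kappa> I; \<forall>i \<in> I. X i \<in> Obj C\<rbrakk>
      \<Longrightarrow> \<exists>S inc. is_coproduct C I X S inc"
    and generator_exists: "\<exists>U. is_generator C U"
    and direct_limits_exact:
      "\<And>(I :: 'k set) r X t Y u Z v f g LX lX LY lY LZ lZ f' g'.
        \<lbrakk>small \<kappa> I; directed_set I r;
         direct_system C I r X t; direct_system C I r Y u; direct_system C I r Z v;
         system_morphism C I r X t Y u f; system_morphism C I r Y u Z v g;
         \<forall>i \<in> I. short_exact C (f i) (g i);
         is_direct_limit C I r X t LX lX; is_direct_limit C I r Y u LY lY;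
         is_direct_limit C I r Z v LZ lZ;
         f' \<in> Hom C LX LY; \<forall>i \<in> I. f' \<cdot> lX i = lY i \<cdot> f i;
         g' \<in> Hom C LY LZ; \<forall>i \<in> I. g' \<cdot> lY i = lZ i \<cdot> g i\<rbrakk>
        \<Longrightarrow> short_exact C f' g'"

section \<open>Functors and natural transformations\<close>

record ('o, 'm, 'p, 'n) func =
  ObjMap :: "'o \<Rightarrow> 'p"
  ArrMap :: "'m \<Rightarrow> 'n"

definition additive_functor ::
  "('o, 'm) precat \<Rightarrow> ('p, 'n) precat \<Rightarrow> ('o, 'm, 'p, 'n) func \<Rightarrow> bool" where
  "additive_functor C D F \<longleftrightarrow>
    (\<forall>X \<in> Obj C. ObjMap F X \<in> Obj D \<and> ArrMap F (Id C X) = Id D (ObjMap F X)) \<and>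
    (\<forall>X Y. \<forall>f \<in> Hom C X Y. ArrMap F f \<in> Hom D (ObjMap F X) (ObjMap F Y)) \<and>
    (\<forall>X Y Z. \<forall>f \<in> Hom C X Y. \<forall>g \<in> Hom C Y Z.
      ArrMap F (g \<cdot>\<^bsub>C\<^esub> f) = ArrMap F g \<cdot>\<^bsub>D\<^esub> ArrMap F f) \<and>
    (\<forall>X Y. \<forall>f \<in> Hom C X Y. \<forall>g \<in> Hom C X Y.
      ArrMap F (Plus C f g) = Plus D (ArrMap F f) (ArrMap F g))"

definition id_func :: "('o, 'm, 'o, 'm) func" where
  "id_func = \<lparr>ObjMap = id, ArrMap = id\<rparr>"

definition comp_func ::
  "('p, 'n, 'q, 'l) func \<Rightarrow> ('o, 'm, 'p, 'n) func \<Rightarrow> ('o, 'm, 'q, 'l) func" (infixr "\<odot>" 75) where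
  "G \<odot> F = \<lparr>ObjMap = ObjMap G \<circ> ObjMap F, ArrMap = ArrMap G \<circ> ArrMap F\<rparr>"

definition right_exact_functor ::
  "('o, 'm) precat \<Rightarrow> ('p, 'n) precat \<Rightarrow> ('o, 'm, 'p, 'n) func \<Rightarrow> bool" where
  "right_exact_functor C D F \<longleftrightarrow> additive_functor C D F \<and>
    (\<forall>f g. exact C f g \<and> epi_arr C g \<longrightarrow>
      exact D (ArrMap F f) (ArrMap F g) \<and> epi_arr D (ArrMap F g))"

definition natural_transformation ::
  "('o, 'm) precat \<Rightarrow> ('p, 'n) precat \<Rightarrow> ('o, 'm, 'p, 'n) func \<Rightarrow> ('o, 'm, 'p, 'n) func \<Rightarrow>
    ('o \<Rightarrow> 'n) \<Rightarrow> bool" where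
  "natural_transformation C D F G \<tau> \<longleftrightarrow>
    (\<forall>X \<in> Obj C. \<tau> X \<in> Hom D (ObjMap F X) (ObjMap G X)) \<and>
    (\<forall>X Y. \<forall>f \<in> Hom C X Y. \<tau> Y \<cdot>\<^bsub>D\<^esub> ArrMap F f = ArrMap G f \<cdot>\<^bsub>D\<^esub> \<tau> X)"

definition naturally_isomorphic ::
  "('o, 'm) precat \<Rightarrow> ('p, 'n) precat \<Rightarrow> ('o, 'm, 'p, 'n) func \<Rightarrow> ('o, 'm, 'p, 'n) func \<Rightarrow> bool" where
  "naturally_isomorphic C D F G \<longleftrightarrow>
    (\<exists>\<tau>. natural_transformation C D F G \<tau> \<and> (\<forall>X \<in> Obj C. iso_arr D (\<tau> X)))"

text \<open>\<open>is_right_adjoint C D L R\<close>: the functor \<open>R : D \<rightarrow> C\<close> is right adjoint to \<open>L : C \<rightarrow> D\<close>.\<close>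

definition is_right_adjoint ::
  "('o, 'm) precat \<Rightarrow> ('p, 'n) precat \<Rightarrow> ('o, 'm, 'p, 'n) func \<Rightarrow> ('p, 'n, 'o, 'm) func \<Rightarrow> bool" where
  "is_right_adjoint C D L R \<longleftrightarrow> additive_functor C D L \<and> additive_functor D C R \<and>
    (\<exists>\<phi>. (\<forall>Y \<in> Obj C. \<forall>X \<in> Obj D.
            bij_betw (\<phi> Y X) (Hom D (ObjMap L Y) X) (Hom C Y (ObjMap R X))) \<and>
         (\<forall>Y \<in> Obj C. \<forall>Y' \<in> Obj C. \<forall>X \<in> Obj D. \<forall>X' \<in> Obj D.
            \<forall>u \<in> Hom C Y' Y. \<forall>f \<in> Hom D (ObjMap L Y) X. \<forall>v \<in> Hom D X X'.
              \<phi> Y' X' (v \<cdot>\<^bsub>D\<^esub> f \<cdot>\<^bsub>D\<^esub> ArrMap L u) = ArrMap R v \<cdot>\<^bsub>C\<^esub> \<phi> Y X f \<cdot>\<^bsub>C\<^esub> u))"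

definition equivalent_via ::
  "('o, 'm) precat \<Rightarrow> ('p, 'n) precat \<Rightarrow> ('o, 'm, 'p, 'n) func \<Rightarrow> ('p, 'n, 'o, 'm) func \<Rightarrow> bool" where
  "equivalent_via C D F G \<longleftrightarrow> additive_functor C D F \<and> additive_functor D C G \<and>
    naturally_isomorphic C C (G \<odot> F) id_func \<and> naturally_isomorphic D D (F \<odot> G) id_func"

section \<open>Localizing subcategories and quotient categories\<close>

text \<open>
  A full subcategory is given by its set of objects. The closure conditions range over all
  monomorphisms, epimorphisms, coproducts and extensions, so closed subcategories contain with
  an object all objects isomorphic to it.
\<close>

definition closed_subcategory :: "'k rel \<Rightarrow> ('o, 'm) precat \<Rightarrow> 'o set \<Rightarrow> bool" where
  "closed_subcategory \<kappa> A S \<longleftrightarrow> S \<subseteq> Obj A \<and>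
    (\<forall>m. mono_arr A m \<and> Cod A m \<in> S \<longrightarrow> Dom A m \<in> S) \<and>
    (\<forall>e. epi_arr A e \<and> Dom A e \<in> S \<longrightarrow> Cod A e \<in> S) \<and>
    (\<forall>(I :: 'k set) X T inc. small \<kappa> I \<and> (\<forall>i \<in> I. X i \<in> S) \<and> is_coproduct A I X T inc \<longrightarrow> T \<in> S)"

definition localizing_subcategory :: "'k rel \<Rightarrow> ('o, 'm) precat \<Rightarrow> 'o set \<Rightarrow> bool" where
  "localizing_subcategory \<kappa> A S \<longleftrightarrow> closed_subcategory \<kappa> A S \<and>
    (\<forall>f g. short_exact A f g \<and> Dom A f \<in> S \<and> Cod A g \<in> S \<longrightarrow> Cod A f \<in> S)"

definition localizing_closure :: "'k rel \<Rightarrow> ('o, 'm) precat \<Rightarrow> 'o set \<Rightarrow> 'o set" where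
  "localizing_closure \<kappa> A S = \<Inter> {L. localizing_subcategory \<kappa> A L \<and> S \<subseteq> L}"

definition torsion_free :: "('o, 'm) precat \<Rightarrow> 'o set \<Rightarrow> 'o \<Rightarrow> bool" where
  "torsion_free A L M \<longleftrightarrow>
    (\<forall>m. mono_arr A m \<and> Dom A m \<in> L \<and> Cod A m = M \<longrightarrow> zero_object A (Dom A m))"

definition relatively_injective :: "('o, 'm) precat \<Rightarrow> 'o set \<Rightarrow> 'o \<Rightarrow> bool" where
  "relatively_injective A L M \<longleftrightarrow>
    (\<forall>i c f. mono_arr A i \<and> is_cokernel A i c \<and> Cod A c \<in> L \<and> f \<in> Hom A (Dom A i) M \<longrightarrow>
      (\<exists>g \<in> Hom A (Cod A i) M. g \<cdot>\<^bsub>A\<^esub> i = f))"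

definition closed_objects :: "('o, 'm) precat \<Rightarrow> 'o set \<Rightarrow> 'o set" where
  "closed_objects A L = {M \<in> Obj A. torsion_free A L M \<and> relatively_injective A L M}"

definition full_subcategory :: "('o, 'm) precat \<Rightarrow> 'o set \<Rightarrow> ('o, 'm) precat" where
  "full_subcategory A S =
    A\<lparr>Obj := S, Arr := {f \<in> Arr A. Dom A f \<in> S \<and> Cod A f \<in> S}\<rparr>"

definition quotient_category :: "('o, 'm) precat \<Rightarrow> 'o set \<Rightarrow> ('o, 'm) precat" where
  "quotient_category A L = full_subcategory A (closed_objects A L)"

section \<open>Wide Morita contexts\<close>

definition right_wide_morita_context ::
  "('a, 'm) precat \<Rightarrow> ('b, 'n) precat \<Rightarrow> ('b, 'n, 'a, 'm) func \<Rightarrow> ('a, 'm, 'b, 'n) func \<Rightarrow>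
    ('a \<Rightarrow> 'm) \<Rightarrow> ('b \<Rightarrow> 'n) \<Rightarrow> bool" where
  "right_wide_morita_context A B F G \<eta> \<rho> \<longleftrightarrow>
    abelian_category A \<and> abelian_category B \<and>
    right_exact_functor B A F \<and> right_exact_functor A B G \<and>
    natural_transformation A A (F \<odot> G) id_func \<eta> \<and>
    natural_transformation B B (G \<odot> F) id_func \<rho> \<and>
    (\<forall>X \<in> Obj A. ArrMap G (\<eta> X) = \<rho> (ObjMap G X)) \<and>
    (\<forall>Y \<in> Obj B. ArrMap F (\<rho> Y) = \<eta> (ObjMap F Y))"

text \<open>
  For a context \<open>(F, G, \<eta>, \<rho>)\<close> between \<open>A\<close> and \<open>B\<close>, the subcategory of \<open>A\<close> defined by the context
  is \<open>annihilated A \<eta>\<close> and that of \<open>B\<close> is \<open>annihilated B \<rho>\<close>.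
\<close>

definition annihilated :: "('o, 'm) precat \<Rightarrow> ('o \<Rightarrow> 'm) \<Rightarrow> 'o set" where
  "annihilated A \<eta> = {X \<in> Obj A. \<forall>M \<in> Obj A. \<forall>f \<in> Hom A M X.
     f \<cdot>\<^bsub>A\<^esub> \<eta> M = Zero A (Dom A (\<eta> M)) X}"

end

theory Submission
  imports Defs
begin

text \<open>
  An object \<open>X\<close> is in \<open>\<C>\<^sub>\<Gamma>\<close> iff \<open>\<eta> X = 0\<close>. The identities \<open>G \<eta> = \<rho> G\<close> and \<open>F \<rho> = \<eta> F\<close> imply that the
  kernel and the cokernel of every \<open>\<eta> M\<close> are in \<open>\<C>\<^sub>\<Gamma>\<close>, and so is the kernel of \<open>F m\<close> for every
  monomorphism \<open>m\<close>. Being right exact and a left adjoint, \<open>F\<close> preserves cokernels and coproducts, so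
  the objects that \<open>F\<close> sends into the localizing closure of \<open>\<C>\<^sub>\<Gamma>\<close> form a localizing subcategory,
  which contains \<open>\<D>\<^sub>\<Gamma>\<close>. Hence \<open>F\<close> maps one localizing closure into the other and is exact modulo it,
  and by adjunction \<open>F'\<close> preserves closed objects. If \<open>X\<close> is closed, then arrows into \<open>X\<close> extend
  uniquely along every \<open>\<eta> M\<close>, so the transpose \<open>X \<rightarrow> G'F'X\<close> of \<open>\<eta> X\<close> is an isomorphism by Yoneda.
\<close>

section \<open>Arrows, kernels and cokernels in a category\<close>

lemma HomD:
  assumes "f \<in> Hom C X Y"
  shows "f \<in> Arr C" "Dom C f = X" "Cod C f = Y"
  using assms by (auto simp: Hom_def)

lemma ArrD: "f \<in> Arr C \<Longrightarrow> f \<in> Hom C (Dom C f) (Cod C f)"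
  by (simp add: Hom_def)

context category
begin

lemma Hom_Obj:
  assumes "f \<in> Hom C X Y"
  shows "X \<in> Obj C" "Y \<in> Obj C"
  using assms Dom_Obj Cod_Obj by (auto simp: Hom_def)

lemma mono_arrI:
  assumes "m \<in> Hom C X Y"
    and "\<And>W f g. \<lbrakk>f \<in> Hom C W X; g \<in> Hom C W X; m \<cdot> f = m \<cdot> g\<rbrakk> \<Longrightarrow> f = g"
  shows "mono_arr C m"
  using assms by (auto simp: mono_arr_def HomD)

lemma mono_arrD:
  assumes "mono_arr C m" "m \<in> Hom C X Y" "f \<in> Hom C W X" "g \<in> Hom C W X" "m \<cdot> f = m \<cdot> g"
  shows "f = g"
  using assms by (auto simp: mono_arr_def HomD)

lemma epi_arrI:
  assumes "e \<in> Hom C X Y"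
    and "\<And>Z f g. \<lbrakk>f \<in> Hom C Y Z; g \<in> Hom C Y Z; f \<cdot> e = g \<cdot> e\<rbrakk> \<Longrightarrow> f = g"
  shows "epi_arr C e"
  using assms by (auto simp: epi_arr_def HomD)

lemma epi_arrD:
  assumes "epi_arr C e" "e \<in> Hom C X Y" "f \<in> Hom C Y Z" "g \<in> Hom C Y Z" "f \<cdot> e = g \<cdot> e"
  shows "f = g"
  using assms by (auto simp: epi_arr_def HomD)

lemma epi_comp:
  assumes "epi_arr C e" "epi_arr C d" "e \<in> Hom C X Y" "d \<in> Hom C Y Z"
  shows "epi_arr C (d \<cdot> e)"
proof (rule epi_arrI)
  show "d \<cdot> e \<in> Hom C X Z" using assms Comp_Hom by blast
  fix W f g assume fg: "f \<in> Hom C Z W" "g \<in> Hom C Z W" "f \<cdot> (d \<cdot> e) = g \<cdot> (d \<cdot> e)"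
  then have "(f \<cdot> d) \<cdot> e = (g \<cdot> d) \<cdot> e" using assms by (simp add: Comp_assoc)
  then have "f \<cdot> d = g \<cdot> d"
    using epi_arrD[OF assms(1,3) Comp_Hom[OF assms(4) fg(1)] Comp_Hom[OF assms(4) fg(2)]] by blast
  then show "f = g" using epi_arrD[OF assms(2,4) fg(1,2)] by blast
qed

lemma mono_cancel:
  assumes "mono_arr C (d \<cdot> e)" "e \<in> Hom C X Y" "d \<in> Hom C Y Z"
  shows "mono_arr C e"
proof (rule mono_arrI[OF assms(2)])
  fix W f g assume fg: "f \<in> Hom C W X" "g \<in> Hom C W X" "e \<cdot> f = e \<cdot> g"
  have "(d \<cdot> e) \<cdot> f = (d \<cdot> e) \<cdot> g"
    using Comp_assoc[OF fg(1) assms(2,3)] Comp_assoc[OF fg(2) assms(2,3)] fg(3) by simp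
  then show "f = g" using mono_arrD[OF assms(1) Comp_Hom[OF assms(2,3)] fg(1,2)] by blast
qed

lemma mono_Id: "X \<in> Obj C \<Longrightarrow> mono_arr C (Id C X)"
  by (rule mono_arrI[OF Id_Hom]) (auto simp: Id_Comp)

lemma kernel_zero:
  assumes "is_kernel C f k" "f \<in> Hom C X Y" "k \<in> Hom C K X"
  shows "f \<cdot> k = Zero C K Y"
  using assms by (auto simp: is_kernel_def HomD)

lemma kernel_factor:
  assumes "is_kernel C f k" "f \<in> Hom C X Y" "k \<in> Hom C K X" "g \<in> Hom C W X"
    "f \<cdot> g = Zero C W Y"
  obtains h where "h \<in> Hom C W K" "k \<cdot> h = g"
proof -
  have "\<exists>!h. h \<in> Hom C W K \<and> k \<cdot> h = g"
    using assms by (auto simp: is_kernel_def HomD)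
  with that show thesis by blast
qed

lemma cokernel_zero:
  assumes "is_cokernel C f c" "f \<in> Hom C X Y" "c \<in> Hom C Y Q"
  shows "c \<cdot> f = Zero C X Q"
  using assms by (auto simp: is_cokernel_def HomD)

lemma cokernel_factor:
  assumes "is_cokernel C f c" "f \<in> Hom C X Y" "c \<in> Hom C Y Q" "g \<in> Hom C Y Z"
    "g \<cdot> f = Zero C X Z"
  obtains h where "h \<in> Hom C Q Z" "h \<cdot> c = g"
proof -
  have "\<exists>!h. h \<in> Hom C Q Z \<and> h \<cdot> c = g"
    using assms by (auto simp: is_cokernel_def HomD)
  with that show thesis by blast
qed

text \<open>Uniqueness of the factor comes from \<open>c\<close> being epic, so only its existence
  has to be supplied.\<close>

lemma cokernelI:
  assumes "f \<in> Hom C X Y" "c \<in> Hom C Y Q" "c \<cdot> f = Zero C X Q" "epi_arr C c"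
    and "\<And>Z g. \<lbrakk>g \<in> Hom C Y Z; g \<cdot> f = Zero C X Z\<rbrakk> \<Longrightarrow> \<exists>h \<in> Hom C Q Z. h \<cdot> c = g"
  shows "is_cokernel C f c"
proof -
  have "\<exists>!h. h \<in> Hom C Q Z \<and> h \<cdot> c = g" if g: "g \<in> Hom C Y Z" "g \<cdot> f = Zero C X Z" for Z g
    using assms(5)[OF g] epi_arrD[OF assms(4,2)] by metis
  then show ?thesis using assms by (auto simp: is_cokernel_def HomD)
qed

end

section \<open>Zero arrows and subtraction in preadditive categories\<close>

context preadditive_category
begin

lemma Zero_Hom: "\<lbrakk>X \<in> Obj C; Y \<in> Obj C\<rbrakk> \<Longrightarrow> Zero C X Y \<in> Hom C X Y"
  using monoid.one_closed[OF group.is_monoid[OF comm_group.axioms(2)[OF hom_comm_group]]]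
  by (simp add: hom_group_def)

lemma Plus_Hom: "\<lbrakk>f \<in> Hom C X Y; g \<in> Hom C X Y\<rbrakk> \<Longrightarrow> Plus C f g \<in> Hom C X Y"
  using monoid.m_closed[OF group.is_monoid[OF comm_group.axioms(2)[OF hom_comm_group[of X Y]]], of f g]
    Hom_Obj[of f X Y]
  by (simp add: hom_group_def)

text \<open>In a group only the neutral element equals its own double. Zero arrows are recognised
  this way from additivity alone.\<close>

lemma Plus_self_zero:
  assumes "f \<in> Hom C X Y" "Plus C f f = f"
  shows "f = Zero C X Y"
  using group.l_cancel_one[OF comm_group.axioms(2)[OF hom_comm_group[of X Y]], of f f]
    Hom_Obj[of f X Y] assms
  by (simp add: hom_group_def)

lemma Zero_Plus: "f \<in> Hom C X Y \<Longrightarrow> Plus C (Zero C X Y) f = f"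
  using monoid.l_one[OF group.is_monoid[OF comm_group.axioms(2)[OF hom_comm_group[of X Y]]], of f]
    Hom_Obj[of f X Y]
  by (simp add: hom_group_def)

lemma Comp_Zero:
  assumes "g \<in> Hom C Y Z" "X \<in> Obj C"
  shows "g \<cdot> Zero C X Y = Zero C X Z"
proof (rule Plus_self_zero)
  have Z: "Zero C X Y \<in> Hom C X Y" using assms Zero_Hom Hom_Obj by blast
  then show "g \<cdot> Zero C X Y \<in> Hom C X Z" using assms Comp_Hom by blast
  show "Plus C (g \<cdot> Zero C X Y) (g \<cdot> Zero C X Y) = g \<cdot> Zero C X Y"
    using Comp_Plus_right[OF Z Z assms(1)] Zero_Plus[OF Z] by simp
qed

lemma Zero_Comp:
  assumes "f \<in> Hom C X Y" "Z \<in> Obj C"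
  shows "Zero C Y Z \<cdot> f = Zero C X Z"
proof (rule Plus_self_zero)
  have Z: "Zero C Y Z \<in> Hom C Y Z" using assms Zero_Hom Hom_Obj by blast
  then show "Zero C Y Z \<cdot> f \<in> Hom C X Z" using assms Comp_Hom by blast
  show "Plus C (Zero C Y Z \<cdot> f) (Zero C Y Z \<cdot> f) = Zero C Y Z \<cdot> f"
    using Comp_Plus_left[OF assms(1) Z Z] Zero_Plus[OF Z] by simp
qed

lemma epi_zero_cancel:
  assumes "epi_arr C e" "e \<in> Hom C X Y" "f \<in> Hom C Y Z" "f \<cdot> e = Zero C X Z"
  shows "f = Zero C Y Z"
  using assms epi_arrD[OF assms(1-3) Zero_Hom] Zero_Comp Hom_Obj by metis

lemma mono_zero_cancel:
  assumes "mono_arr C m" "m \<in> Hom C X Y" "f \<in> Hom C W X" "m \<cdot> f = Zero C W Y"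
  shows "f = Zero C W X"
  using assms mono_arrD[OF assms(1-3) Zero_Hom] Comp_Zero Hom_Obj by metis

text \<open>The last property is cancellation of \<open>g'\<close>. It lets arguments about
  differences of arrows run with \<open>Plus\<close> and \<open>Zero\<close> only.\<close>

lemma Hom_inverse:
  assumes "g \<in> Hom C X Y"
  obtains g' where "g' \<in> Hom C X Y" "Plus C g g' = Zero C X Y"
    "\<And>f. \<lbrakk>f \<in> Hom C X Y; Plus C f g' = Zero C X Y\<rbrakk> \<Longrightarrow> f = g"
proof -
  interpret H: comm_group "hom_group C X Y" using hom_comm_group Hom_Obj assms by blast
  have car: "carrier (hom_group C X Y) = Hom C X Y" by (simp add: hom_group_def)
  define g' where "g' = inv\<^bsub>hom_group C X Y\<^esub> g"
  have "g' \<in> Hom C X Y" using H.inv_closed[of g] assms car g'_def by simp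
  moreover have "Plus C g g' = Zero C X Y"
    using H.r_inv[of g] assms car g'_def by (simp add: hom_group_def)
  moreover have "f = g" if "f \<in> Hom C X Y" "Plus C f g' = Zero C X Y" for f
  proof -
    have "f \<otimes>\<^bsub>hom_group C X Y\<^esub> g' = g \<otimes>\<^bsub>hom_group C X Y\<^esub> g'"
      using that calculation(2) by (simp add: hom_group_def)
    then show ?thesis using H.right_cancel car that assms calculation(1) by metis
  qed
  ultimately show thesis using that by blast
qed

text \<open>If \<open>m\<close> equalises \<open>f\<close> and \<open>g\<close>, it kills their
  difference, so a trivial kernel suffices.\<close>

lemma mono_zeroI:
  assumes "m \<in> Hom C X Y"
    and z: "\<And>W f. \<lbrakk>f \<in> Hom C W X; m \<cdot> f = Zero C W Y\<rbrakk> \<Longrightarrow> f = Zero C W X"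
  shows "mono_arr C m"
proof (rule mono_arrI[OF assms(1)])
  fix W f g assume fg: "f \<in> Hom C W X" "g \<in> Hom C W X" "m \<cdot> f = m \<cdot> g"
  obtain g' where g': "g' \<in> Hom C W X" "Plus C g g' = Zero C W X"
    "\<And>f. \<lbrakk>f \<in> Hom C W X; Plus C f g' = Zero C W X\<rbrakk> \<Longrightarrow> f = g"
    using Hom_inverse[OF fg(2)] by blast
  have "m \<cdot> Plus C f g' = m \<cdot> Plus C g g'"
    using Comp_Plus_right assms(1) fg g'(1) by metis
  also have "\<dots> = Zero C W Y" using g'(2) Comp_Zero assms(1) Hom_Obj fg(1) by metis
  finally show "f = g" using z[OF Plus_Hom[OF fg(1) g'(1)]] g'(3) fg by blast
qed

lemma kernel_mono:
  assumes "is_kernel C f k" "f \<in> Hom C X Y" "k \<in> Hom C K X"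
  shows "mono_arr C k"
proof (rule mono_arrI[OF assms(3)])
  fix W g h assume gh: "g \<in> Hom C W K" "h \<in> Hom C W K" "k \<cdot> g = k \<cdot> h"
  have "f \<cdot> (k \<cdot> g) = Zero C W Y"
    using Comp_assoc[OF gh(1) assms(3,2)] kernel_zero[OF assms] Zero_Comp[OF gh(1)] assms Hom_Obj
    by metis
  then have "\<exists>!h. h \<in> Hom C W K \<and> k \<cdot> h = k \<cdot> g"
    using assms Comp_Hom[OF gh(1) assms(3)] by (auto simp: is_kernel_def HomD)
  then show "g = h" using gh by metis
qed

lemma cokernel_epi:
  assumes "is_cokernel C f c" "f \<in> Hom C X Y" "c \<in> Hom C Y Q"
  shows "epi_arr C c"
proof (rule epi_arrI[OF assms(3)])
  fix Z g h assume gh: "g \<in> Hom C Q Z" "h \<in> Hom C Q Z" "g \<cdot> c = h \<cdot> c"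
  have "(g \<cdot> c) \<cdot> f = Zero C X Z"
    using Comp_assoc[OF assms(2,3) gh(1)] cokernel_zero[OF assms] Comp_Zero[OF gh(1)] assms Hom_Obj
    by metis
  then have "\<exists>!h. h \<in> Hom C Q Z \<and> h \<cdot> c = g \<cdot> c"
    using assms Comp_Hom[OF assms(3) gh(1)] by (auto simp: is_cokernel_def HomD)
  then show "g = h" using gh by metis
qed

lemma zero_object_arr:
  assumes "zero_object C Z" "f \<in> Hom C Z X"
  shows "f = Zero C Z X"
  using assms Zero_Hom Hom_Obj[OF assms(2)] unfolding zero_object_def by blast

text \<open>Every arrow into or out of \<open>Z\<close> factors through the identity of
  \<open>Z\<close>, so it vanishes with it.\<close>

lemma zero_objectI:
  assumes Z: "Z \<in> Obj C" and I: "Id C Z = Zero C Z Z"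
  shows "zero_object C Z"
proof -
  have "f = Zero C X Z" if f: "f \<in> Hom C X Z" for X f
    using Id_Comp[OF f] Zero_Comp[OF f Z] I by simp
  moreover have "f = Zero C Z X" if f: "f \<in> Hom C Z X" for X f
    using Comp_Id[OF f] Comp_Zero[OF f Z] I by simp
  ultimately show ?thesis using Zero_Hom Z unfolding zero_object_def by metis
qed

end

section \<open>Additive functors\<close>

lemma additive_functor_Hom:
  "\<lbrakk>additive_functor C D F; f \<in> Hom C X Y\<rbrakk> \<Longrightarrow> ArrMap F f \<in> Hom D (ObjMap F X) (ObjMap F Y)"
  by (auto simp: additive_functor_def)

lemma additive_functor_Obj:
  "\<lbrakk>additive_functor C D F; X \<in> Obj C\<rbrakk> \<Longrightarrow> ObjMap F X \<in> Obj D"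
  by (auto simp: additive_functor_def)

lemma additive_functor_Id:
  "\<lbrakk>additive_functor C D F; X \<in> Obj C\<rbrakk> \<Longrightarrow> ArrMap F (Id C X) = Id D (ObjMap F X)"
  by (auto simp: additive_functor_def)

lemma additive_functor_Comp:
  "\<lbrakk>additive_functor C D F; f \<in> Hom C X Y; g \<in> Hom C Y Z\<rbrakk>
    \<Longrightarrow> ArrMap F (g \<cdot>\<^bsub>C\<^esub> f) = ArrMap F g \<cdot>\<^bsub>D\<^esub> ArrMap F f"
  unfolding additive_functor_def by blast

lemma additive_functor_Zero:
  assumes "preadditive_category C" "preadditive_category D" "additive_functor C D F"
    "X \<in> Obj C" "Y \<in> Obj C"
  shows "ArrMap F (Zero C X Y) = Zero D (ObjMap F X) (ObjMap F Y)"
proof -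
  interpret C: preadditive_category C by fact
  interpret D: preadditive_category D by fact
  have z: "Zero C X Y \<in> Hom C X Y" using C.Zero_Hom assms by blast
  have "Plus D (ArrMap F (Zero C X Y)) (ArrMap F (Zero C X Y)) = ArrMap F (Zero C X Y)"
    using assms(3) z C.Zero_Plus[OF z] unfolding additive_functor_def by metis
  then show ?thesis using D.Plus_self_zero additive_functor_Hom[OF assms(3) z] by blast
qed

section \<open>Image factorization and exactness in abelian categories\<close>

context abelian_category
begin

lemma obtain_kernel:
  assumes "f \<in> Hom C X Y"
  obtains K k where "is_kernel C f k" "k \<in> Hom C K X"
proof -
  obtain k where k: "is_kernel C f k" using kernel_exists assms HomD by metis
  then have "k \<in> Hom C (Dom C k) X" using assms by (auto simp: is_kernel_def Hom_def)
  with k show thesis using that by blast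
qed

lemma obtain_cokernel:
  assumes "f \<in> Hom C X Y"
  obtains Q c where "is_cokernel C f c" "c \<in> Hom C Y Q"
proof -
  obtain c where c: "is_cokernel C f c" using cokernel_exists assms HomD by metis
  then have "c \<in> Hom C Y (Cod C c)" using assms by (auto simp: is_cokernel_def Hom_def)
  with c show thesis using that by blast
qed

lemma obtain_epi_cokernel:
  assumes "epi_arr C e" "e \<in> Hom C X Y"
  obtains W h where "h \<in> Hom C W X" "is_cokernel C h e"
proof -
  obtain h where h: "is_cokernel C h e" using epi_is_cokernel assms by blast
  then have "h \<in> Hom C (Dom C h) X" using assms by (auto simp: is_cokernel_def Hom_def)
  with h show thesis using that by blast
qed

text \<open>The epimorphism is a cokernel of some \<open>f\<close>, and \<open>f\<close> factors
  through \<open>k\<close>. Hence whatever kills \<open>k\<close> also kills \<open>f\<close> and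
  factors through \<open>e\<close>.\<close>

lemma epi_cokernel_of_kernel:
  assumes "epi_arr C e" "e \<in> Hom C X Y" "is_kernel C e k" "k \<in> Hom C K X"
  shows "is_cokernel C k e"
proof (rule cokernelI[OF assms(4,2) _ assms(1)])
  show "e \<cdot> k = Zero C K Y" using kernel_zero assms by blast
  fix Z g assume g: "g \<in> Hom C X Z" "g \<cdot> k = Zero C K Z"
  obtain W f where f: "f \<in> Hom C W X" "is_cokernel C f e" using obtain_epi_cokernel assms by blast
  obtain s where s: "s \<in> Hom C W K" "k \<cdot> s = f"
    using kernel_factor[OF assms(3,2,4) f(1) cokernel_zero[OF f(2,1) assms(2)]] by blast
  have "g \<cdot> f = Zero C W Z"
    using Comp_assoc[OF s(1) assms(4) g(1)] s g Zero_Comp Hom_Obj by metis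
  then show "\<exists>h\<in>Hom C Y Z. h \<cdot> e = g" using cokernel_factor[OF f(2,1) assms(2) g(1)] by blast
qed

text \<open>The object \<open>I\<close> is the coimage: \<open>e\<close> is a cokernel of the kernel
  of \<open>f\<close>. To see that \<open>i\<close> is monic, an arrow \<open>x\<close> killed by
  \<open>i\<close> is tested by its cokernel \<open>q\<close>, which turns out to be a split
  monomorphism.\<close>

lemma epi_mono_factorization:
  assumes f: "f \<in> Hom C X Y" and k: "is_kernel C f k" "k \<in> Hom C K X"
  obtains I e i where "e \<in> Hom C X I" "i \<in> Hom C I Y" "i \<cdot> e = f" "epi_arr C e" "mono_arr C i"
    "is_cokernel C k e"
proof -
  obtain I e where e: "is_cokernel C k e" "e \<in> Hom C X I" using obtain_cokernel[OF k(2)] by blast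
  have epe: "epi_arr C e" using cokernel_epi e k by blast
  obtain i where i: "i \<in> Hom C I Y" "i \<cdot> e = f"
    using cokernel_factor[OF e(1) k(2) e(2) f kernel_zero[OF k(1) f k(2)]] by blast
  have "mono_arr C i"
  proof (rule mono_zeroI[OF i(1)])
    fix W x assume x: "x \<in> Hom C W I" "i \<cdot> x = Zero C W Y"
    obtain Z q where q: "is_cokernel C x q" "q \<in> Hom C I Z" using obtain_cokernel[OF x(1)] by blast
    obtain j where j: "j \<in> Hom C Z Y" "j \<cdot> q = i"
      using cokernel_factor[OF q(1) x(1) q(2) i(1) x(2)] by blast
    have qe: "epi_arr C (q \<cdot> e)" "q \<cdot> e \<in> Hom C X Z"
      using epi_comp[OF epe cokernel_epi[OF q(1) x(1) q(2)] e(2) q(2)] Comp_Hom[OF e(2) q(2)] by blast+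
    obtain V h where h: "h \<in> Hom C V X" "is_cokernel C h (q \<cdot> e)"
      using obtain_epi_cokernel[OF qe] by blast
    \<comment> \<open>Since \<open>f\<close> factors through the epimorphism
      \<open>q \<cdot> e\<close>, it kills the arrow \<open>h\<close> of which that epimorphism is a
      cokernel. So \<open>h\<close> factors through \<open>k\<close>, \<open>e\<close> kills
      \<open>h\<close>, and \<open>e\<close> factors through \<open>q \<cdot> e\<close>.\<close>
    have "f = j \<cdot> (q \<cdot> e)" using Comp_assoc[OF e(2) q(2) j(1)] i j by simp
    then have "f \<cdot> h = Zero C V Y"
      using Comp_assoc[OF h(1) qe(2) j(1)] cokernel_zero[OF h(2,1) qe(2)] Comp_Zero j Hom_Obj h
      by metis
    then obtain h' where h': "h' \<in> Hom C V K" "k \<cdot> h' = h"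
      using kernel_factor[OF k(1) f k(2) h(1)] by blast
    have "e \<cdot> h = Zero C V I"
      using Comp_assoc[OF h'(1) k(2) e(2)] cokernel_zero[OF e(1) k(2) e(2)] h' Zero_Comp Hom_Obj e
      by metis
    then obtain s where s: "s \<in> Hom C Z I" "s \<cdot> (q \<cdot> e) = e"
      using cokernel_factor[OF h(2,1) qe(2) e(2)] by blast
    have "(s \<cdot> q) \<cdot> e = Id C I \<cdot> e" using Comp_assoc[OF e(2) q(2) s(1)] s Id_Comp e by simp
    then have sq: "s \<cdot> q = Id C I"
      using epi_arrD[OF epe e(2) Comp_Hom[OF q(2) s(1)] Id_Hom] Hom_Obj e by blast
    then have "mono_arr C q"
      using mono_cancel[OF _ q(2) s(1)] mono_Id Hom_Obj e by metis
    then show "x = Zero C W I" using mono_zero_cancel q x cokernel_zero by blast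
  qed
  then show thesis using that e epe i by blast
qed

text \<open>Exactness provides one \<open>k\<close> that is a kernel both of \<open>g\<close> and of
  a cokernel \<open>c\<close> of \<open>f\<close>. An arrow killing \<open>f\<close> factors through
  \<open>c\<close>, hence kills \<open>k\<close>, and the epimorphism \<open>g\<close> is a cokernel
  of \<open>k\<close>.\<close>

lemma exact_epi_cokernel:
  assumes "exact C f g" "epi_arr C g" "f \<in> Hom C X Y" "g \<in> Hom C Y Z"
  shows "is_cokernel C f g"
proof -
  obtain c k where ck: "is_cokernel C f c" "is_kernel C c k" "is_kernel C g k"
    using assms(1) by (auto simp: exact_def)
  define Q K where "Q = Cod C c" and "K = Dom C k"
  have cH: "c \<in> Hom C Y Q" using ck(1) assms(3) by (auto simp: Q_def is_cokernel_def Hom_def)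
  have kH: "k \<in> Hom C K Y" using ck(3) assms(4) by (auto simp: K_def is_kernel_def Hom_def)
  obtain f' where f': "f' \<in> Hom C X K" "k \<cdot> f' = f"
    using kernel_factor[OF ck(2) cH kH assms(3) cokernel_zero[OF ck(1) assms(3) cH]] by blast
  have gk: "is_cokernel C k g" using epi_cokernel_of_kernel assms ck kH by blast
  show ?thesis
  proof (rule cokernelI[OF assms(3,4) _ assms(2)])
    show "g \<cdot> f = Zero C X Z"
      using Comp_assoc[OF f'(1) kH assms(4)] kernel_zero[OF ck(3) assms(4) kH] f'
        Zero_Comp assms Hom_Obj by metis
    fix W h assume h: "h \<in> Hom C Y W" "h \<cdot> f = Zero C X W"
    obtain s where s: "s \<in> Hom C Q W" "s \<cdot> c = h"
      using cokernel_factor[OF ck(1) assms(3) cH h] by blast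
    have "h \<cdot> k = Zero C K W"
      using Comp_assoc[OF kH cH s(1)] kernel_zero[OF ck(2) cH kH] s Comp_Zero Hom_Obj kH by metis
    then show "\<exists>t\<in>Hom C Z W. t \<cdot> g = h" using cokernel_factor[OF gk kH assms(4) h(1)] by blast
  qed
qed

lemma cokernel_exact:
  assumes "is_cokernel C f g" "f \<in> Hom C X Y" "g \<in> Hom C Y Z"
  shows "exact C f g"
  using obtain_kernel[OF assms(3)] assms(1) unfolding exact_def by metis

lemma mono_cokernel_short_exact:
  assumes "mono_arr C f" "is_cokernel C f g" "f \<in> Hom C X Y" "g \<in> Hom C Y Z"
  shows "short_exact C f g"
  using assms cokernel_epi cokernel_exact by (auto simp: short_exact_def)

text \<open>An arrow kills \<open>i\<close> exactly when it kills \<open>i \<cdot> e\<close>,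
  because \<open>e\<close> is epic. This passes from an arrow to its image without changing the
  cokernel.\<close>

lemma cokernel_cancel_epi:
  assumes "is_cokernel C (i \<cdot> e) c" "epi_arr C e"
    "e \<in> Hom C X I" "i \<in> Hom C I Y" "c \<in> Hom C Y Q"
  shows "is_cokernel C i c"
proof -
  have ie: "i \<cdot> e \<in> Hom C X Y" using Comp_Hom assms by blast
  show ?thesis
  proof (rule cokernelI[OF assms(4,5) _ cokernel_epi[OF assms(1) ie assms(5)]])
    show "c \<cdot> i = Zero C I Q"
      using epi_zero_cancel[OF assms(2,3) Comp_Hom[OF assms(4,5)]] Comp_assoc[OF assms(3-5)]
        cokernel_zero[OF assms(1) ie assms(5)] by simp
    fix Z g assume g: "g \<in> Hom C Y Z" "g \<cdot> i = Zero C I Z"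
    have "g \<cdot> (i \<cdot> e) = Zero C X Z"
      using Comp_assoc[OF assms(3,4) g(1)] g Zero_Comp assms Hom_Obj by metis
    then show "\<exists>h\<in>Hom C Q Z. h \<cdot> c = g"
      using cokernel_factor[OF assms(1) ie assms(5) g(1)] by blast
  qed
qed

end

section \<open>Right exact functors\<close>

lemma right_exact_additive: "right_exact_functor C D F \<Longrightarrow> additive_functor C D F"
  by (simp add: right_exact_functor_def)

lemma right_exact_cokernel:
  assumes "abelian_category C" "abelian_category D" "right_exact_functor C D F"
    "is_cokernel C f c" "f \<in> Hom C X Y" "c \<in> Hom C Y Q"
  shows "is_cokernel D (ArrMap F f) (ArrMap F c)"
proof -
  interpret C: abelian_category C by fact
  interpret D: abelian_category D by fact
  have "exact C f c \<and> epi_arr C c" using C.cokernel_exact C.cokernel_epi assms by blast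
  then have "exact D (ArrMap F f) (ArrMap F c)" "epi_arr D (ArrMap F c)"
    using assms(3) by (auto simp: right_exact_functor_def)
  then show ?thesis
    using D.exact_epi_cokernel additive_functor_Hom[OF right_exact_additive[OF assms(3)]] assms(5,6)
    by blast
qed

text \<open>An epimorphism is a cokernel, and the functor preserves cokernels.\<close>

lemma right_exact_epi:
  assumes "abelian_category C" "abelian_category D" "right_exact_functor C D F"
    "epi_arr C e" "e \<in> Hom C X Y"
  shows "epi_arr D (ArrMap F e)"
proof -
  interpret C: abelian_category C by fact
  interpret D: abelian_category D by fact
  note F = additive_functor_Hom[OF right_exact_additive[OF assms(3)]]
  obtain W h where h: "h \<in> Hom C W X" "is_cokernel C h e"
    using C.obtain_epi_cokernel assms by blast
  show ?thesis
    using D.cokernel_epi[OF right_exact_cokernel[OF assms(1-3) h(2,1) assms(5)] F[OF h(1)] F[OF assms(5)]] .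
qed


section \<open>Localizing subcategories and closed objects\<close>

lemma closed_subcategory_sub:
  "\<lbrakk>closed_subcategory \<kappa> C L; mono_arr C m; m \<in> Hom C X Y; Y \<in> L\<rbrakk> \<Longrightarrow> X \<in> L"
  by (auto simp: closed_subcategory_def Hom_def)

lemma closed_subcategory_quotient:
  "\<lbrakk>closed_subcategory \<kappa> C L; epi_arr C e; e \<in> Hom C X Y; X \<in> L\<rbrakk> \<Longrightarrow> Y \<in> L"
  by (auto simp: closed_subcategory_def Hom_def)

lemma closed_subcategory_coproduct:
  fixes \<kappa> :: "'k rel" and I :: "'k set"
  shows "\<lbrakk>closed_subcategory \<kappa> C L; small \<kappa> I; \<forall>i \<in> I. X i \<in> L; is_coproduct C I X T inc\<rbrakk>
    \<Longrightarrow> T \<in> L"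
  unfolding closed_subcategory_def by blast

lemma localizing_subcategory_extension:
  "\<lbrakk>localizing_subcategory \<kappa> C L; short_exact C f g; f \<in> Hom C X Y; g \<in> Hom C Y Z;
    X \<in> L; Z \<in> L\<rbrakk> \<Longrightarrow> Y \<in> L"
  by (auto simp: localizing_subcategory_def Hom_def)

lemma localizing_closed: "localizing_subcategory \<kappa> C L \<Longrightarrow> closed_subcategory \<kappa> C L"
  by (simp add: localizing_subcategory_def)

lemma localizing_closure_least:
  "\<lbrakk>localizing_subcategory \<kappa> C L; S \<subseteq> L\<rbrakk> \<Longrightarrow> localizing_closure \<kappa> C S \<subseteq> L"
  by (auto simp: localizing_closure_def)

lemma localizing_closure_superset: "S \<subseteq> localizing_closure \<kappa> C S"
  by (auto simp: localizing_closure_def)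

context category
begin

text \<open>This makes the family intersected in \<open>localizing_closure\<close> nonempty, so that
  the intersection consists of objects of the category.\<close>

lemma localizing_subcategory_Obj: "localizing_subcategory \<kappa> C (Obj C)"
  unfolding localizing_subcategory_def closed_subcategory_def
  by (auto simp: mono_arr_def epi_arr_def short_exact_def is_coproduct_def intro: Dom_Obj Cod_Obj)

lemma localizing_subcategory_Inter:
  fixes \<kappa> :: "'k rel"
  assumes "\<L> \<noteq> {}" "\<And>L. L \<in> \<L> \<Longrightarrow> localizing_subcategory \<kappa> C L"
  shows "localizing_subcategory \<kappa> C (\<Inter>\<L>)"
proof -
  have cl: "closed_subcategory \<kappa> C L" if "L \<in> \<L>" for L
    using that assms(2) localizing_closed by blast
  have "T \<in> L"
    if "small \<kappa> I" "\<forall>i \<in> I. X i \<in> \<Inter>\<L>" "is_coproduct C I X T inc" "L \<in> \<L>"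
    for I :: "'k set" and X T inc L
    using closed_subcategory_coproduct[OF cl[OF that(4)] that(1) _ that(3)] that(2,4) by blast
  moreover have "\<Inter>\<L> \<subseteq> Obj C" using cl assms(1) unfolding closed_subcategory_def by blast
  moreover have "Dom C m \<in> \<Inter>\<L>" if "mono_arr C m" "Cod C m \<in> \<Inter>\<L>" for m
    using cl that unfolding closed_subcategory_def by blast
  moreover have "Cod C e \<in> \<Inter>\<L>" if "epi_arr C e" "Dom C e \<in> \<Inter>\<L>" for e
    using cl that unfolding closed_subcategory_def by blast
  moreover have "Cod C f \<in> \<Inter>\<L>"
    if "short_exact C f g" "Dom C f \<in> \<Inter>\<L>" "Cod C g \<in> \<Inter>\<L>" for f g
    using assms(2) that unfolding localizing_subcategory_def by blast
  ultimately show ?thesis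
    unfolding localizing_subcategory_def closed_subcategory_def by blast
qed

lemma localizing_closure_localizing:
  assumes "S \<subseteq> Obj C"
  shows "localizing_subcategory \<kappa> C (localizing_closure \<kappa> C S)"
  unfolding localizing_closure_def
  by (rule localizing_subcategory_Inter) (use assms localizing_subcategory_Obj in blast)+

end

section \<open>Extension and cancellation of arrows into closed objects\<close>

context abelian_category
begin

text \<open>The image of \<open>f\<close> is a quotient of \<open>N\<close>, hence in
  \<open>L\<close>, and embeds in \<open>M\<close>, so it is zero.\<close>

lemma torsion_free_zero:
  assumes L: "closed_subcategory \<kappa> C L" and M: "torsion_free C L M"
    and f: "f \<in> Hom C N M" and N: "N \<in> L"
  shows "f = Zero C N M"
proof -
  obtain K k where k: "is_kernel C f k" "k \<in> Hom C K N" using obtain_kernel[OF f] by blast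
  obtain I e i where ei: "e \<in> Hom C N I" "i \<in> Hom C I M" "i \<cdot> e = f" "epi_arr C e" "mono_arr C i"
    using epi_mono_factorization[OF f k] by blast
  have "I \<in> L" using closed_subcategory_quotient[OF L ei(4,1) N] .
  then have "zero_object C I" using M ei by (auto simp: torsion_free_def Hom_def)
  then have "i = Zero C I M" using zero_object_arr ei by blast
  then show ?thesis using Zero_Comp[OF ei(1)] ei(3) Hom_Obj f by metis
qed

text \<open>Write \<open>a = i \<cdot> e\<close> through its image. Torsion-freeness makes
  \<open>f\<close> vanish on the kernel, so \<open>f\<close> descends along \<open>e\<close>.
  Relative injectivity then extends it along \<open>i\<close>, whose cokernel is that of
  \<open>a\<close>.\<close>

lemma closed_object_extend:
  assumes L: "closed_subcategory \<kappa> C L" and X: "X \<in> closed_objects C L"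
    and a: "a \<in> Hom C P M"
    and k: "is_kernel C a k" "k \<in> Hom C K P" "K \<in> L"
    and c: "is_cokernel C a c" "c \<in> Hom C M Q" "Q \<in> L"
    and f: "f \<in> Hom C P X"
  obtains g where "g \<in> Hom C M X" "g \<cdot> a = f"
proof -
  obtain I e i where ei: "e \<in> Hom C P I" "i \<in> Hom C I M" "i \<cdot> e = a" "epi_arr C e" "mono_arr C i"
    "is_cokernel C k e"
    using epi_mono_factorization[OF a k(1,2)] by blast
  have "f \<cdot> k = Zero C K X"
    using torsion_free_zero[OF L _ Comp_Hom[OF k(2) f] k(3)] X by (simp add: closed_objects_def)
  then obtain f1 where f1: "f1 \<in> Hom C I X" "f1 \<cdot> e = f"
    using cokernel_factor[OF ei(6) k(2) ei(1) f] by blast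
  have "is_cokernel C i c"
    using cokernel_cancel_epi[OF _ ei(4,1,2) c(2)] c(1) ei(3) by simp
  moreover have "relatively_injective C L X" using X by (simp add: closed_objects_def)
  ultimately have "\<exists>g \<in> Hom C M X. g \<cdot> i = f1"
    unfolding relatively_injective_def using ei(5) c(3) f1(1) HomD[OF ei(2)] HomD[OF c(2)] by metis
  then obtain g where g: "g \<in> Hom C M X" "g \<cdot> i = f1" by blast
  have "g \<cdot> a = f" using Comp_assoc[OF ei(1,2) g(1)] g(2) ei(3) f1(2) by simp
  with g(1) show thesis using that by blast
qed

text \<open>The difference of \<open>g\<close> and \<open>h\<close> kills \<open>a\<close>, so it
  factors through \<open>Q\<close>; arrows from an object of \<open>L\<close> to a torsion-free
  object vanish.\<close>

lemma closed_object_cancel: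
  assumes L: "closed_subcategory \<kappa> C L" and X: "X \<in> closed_objects C L"
    and a: "a \<in> Hom C P M"
    and c: "is_cokernel C a c" "c \<in> Hom C M Q" "Q \<in> L"
    and gh: "g \<in> Hom C M X" "h \<in> Hom C M X" "g \<cdot> a = h \<cdot> a"
  shows "g = h"
proof -
  obtain h' where h': "h' \<in> Hom C M X" "Plus C h h' = Zero C M X"
    "\<And>f. \<lbrakk>f \<in> Hom C M X; Plus C f h' = Zero C M X\<rbrakk> \<Longrightarrow> f = h"
    using Hom_inverse[OF gh(2)] by blast
  have d: "Plus C g h' \<in> Hom C M X" using Plus_Hom gh h' by blast
  have "Plus C g h' \<cdot> a = Plus C h h' \<cdot> a"
    using Comp_Plus_left[OF a gh(1) h'(1)] Comp_Plus_left[OF a gh(2) h'(1)] gh(3) by simp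
  also have "\<dots> = Zero C P X" using Zero_Comp[OF a] h'(2) Hom_Obj(2)[OF gh(1)] by simp
  finally obtain t where t: "t \<in> Hom C Q X" "t \<cdot> c = Plus C g h'"
    using cokernel_factor[OF c(1) a c(2) d] by blast
  have "t = Zero C Q X"
    using torsion_free_zero[OF L _ t(1) c(3)] X by (simp add: closed_objects_def)
  then have "Plus C g h' = Zero C M X" using Zero_Comp[OF c(2)] t Hom_Obj(2)[OF gh(1)] by simp
  then show ?thesis using h'(3) gh(1) by blast
qed

end

section \<open>Adjunctions\<close>

text \<open>The adjunction bijection with naturality split into its two variables. Object conditions
  that follow from the arrows are left out.\<close>

locale hom_bijection =
  fixes C :: "('o, 'm) precat" and D :: "('p, 'n) precat"
    and L :: "('o, 'm, 'p, 'n) func" and R :: "('p, 'n, 'o, 'm) func"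
    and \<phi> :: "'o \<Rightarrow> 'p \<Rightarrow> 'n \<Rightarrow> 'm"
  assumes Hom: "\<lbrakk>Y \<in> Obj C; f \<in> Hom D (ObjMap L Y) X\<rbrakk> \<Longrightarrow> \<phi> Y X f \<in> Hom C Y (ObjMap R X)"
    and inj: "\<lbrakk>Y \<in> Obj C; f \<in> Hom D (ObjMap L Y) X; g \<in> Hom D (ObjMap L Y) X;
      \<phi> Y X f = \<phi> Y X g\<rbrakk> \<Longrightarrow> f = g"
    and surj: "\<lbrakk>X \<in> Obj D; h \<in> Hom C Y (ObjMap R X)\<rbrakk>
      \<Longrightarrow> \<exists>f \<in> Hom D (ObjMap L Y) X. \<phi> Y X f = h"
    and natural_left: "\<lbrakk>u \<in> Hom C Y' Y; f \<in> Hom D (ObjMap L Y) X\<rbrakk>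
      \<Longrightarrow> \<phi> Y' X (f \<cdot>\<^bsub>D\<^esub> ArrMap L u) = \<phi> Y X f \<cdot>\<^bsub>C\<^esub> u"
    and natural_right: "\<lbrakk>Y \<in> Obj C; f \<in> Hom D (ObjMap L Y) X; v \<in> Hom D X X'\<rbrakk>
      \<Longrightarrow> \<phi> Y X' (v \<cdot>\<^bsub>D\<^esub> f) = ArrMap R v \<cdot>\<^bsub>C\<^esub> \<phi> Y X f"

text \<open>Setting one of the two arrows in the joint naturality law to an identity gives each
  one-sided law, since functors preserve identities.\<close>

lemma right_adjoint_hom_bijection:
  assumes "category C" "category D" and adj: "is_right_adjoint C D L R"
  obtains \<phi> where "hom_bijection C D L R \<phi>"
proof -
  interpret C: category C by fact
  interpret D: category D by fact
  have L: "additive_functor C D L" and R: "additive_functor D C R"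
    using adj by (auto simp: is_right_adjoint_def)
  obtain \<phi> where bij: "\<And>Y X. \<lbrakk>Y \<in> Obj C; X \<in> Obj D\<rbrakk>
      \<Longrightarrow> bij_betw (\<phi> Y X) (Hom D (ObjMap L Y) X) (Hom C Y (ObjMap R X))"
    and nat: "\<And>Y Y' X X' u f v. \<lbrakk>Y \<in> Obj C; Y' \<in> Obj C; X \<in> Obj D; X' \<in> Obj D;
        u \<in> Hom C Y' Y; f \<in> Hom D (ObjMap L Y) X; v \<in> Hom D X X'\<rbrakk>
      \<Longrightarrow> \<phi> Y' X' (v \<cdot>\<^bsub>D\<^esub> f \<cdot>\<^bsub>D\<^esub> ArrMap L u) = ArrMap R v \<cdot>\<^bsub>C\<^esub> \<phi> Y X f \<cdot>\<^bsub>C\<^esub> u"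
    using adj unfolding is_right_adjoint_def by blast
  have Hom: "\<phi> Y X f \<in> Hom C Y (ObjMap R X)"
    if "Y \<in> Obj C" "f \<in> Hom D (ObjMap L Y) X" for Y X f
    using bij_betwE[OF bij[OF that(1) D.Hom_Obj(2)[OF that(2)]]] that(2) by blast
  have "hom_bijection C D L R \<phi>"
  proof
    show "\<phi> Y X f \<in> Hom C Y (ObjMap R X)"
      if "Y \<in> Obj C" "f \<in> Hom D (ObjMap L Y) X" for Y X f
      using that by (rule Hom)
    show "f = g"
      if "Y \<in> Obj C" "f \<in> Hom D (ObjMap L Y) X" "g \<in> Hom D (ObjMap L Y) X"
        "\<phi> Y X f = \<phi> Y X g" for Y X f g
      using inj_onD[OF bij_betw_imp_inj_on[OF bij[OF that(1) D.Hom_Obj(2)[OF that(2)]]] that(4,2,3)] .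
    show "\<exists>f \<in> Hom D (ObjMap L Y) X. \<phi> Y X f = h"
      if "X \<in> Obj D" "h \<in> Hom C Y (ObjMap R X)" for X Y h
    proof -
      have "h \<in> \<phi> Y X ` Hom D (ObjMap L Y) X"
        using bij_betw_imp_surj_on[OF bij[OF C.Hom_Obj(1)[OF that(2)] that(1)]] that(2) by simp
      then show ?thesis by blast
    qed
  next
    fix u Y' Y f X assume u: "u \<in> Hom C Y' Y" and f: "f \<in> Hom D (ObjMap L Y) X"
    have X: "X \<in> Obj D" and Y: "Y \<in> Obj C" "Y' \<in> Obj C"
      using D.Hom_Obj[OF f] C.Hom_Obj[OF u] by blast+
    have fu: "f \<cdot>\<^bsub>D\<^esub> ArrMap L u \<in> Hom D (ObjMap L Y') X"
      using D.Comp_Hom[OF additive_functor_Hom[OF L u] f] .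
    have pu: "\<phi> Y X f \<cdot>\<^bsub>C\<^esub> u \<in> Hom C Y' (ObjMap R X)" using C.Comp_Hom[OF u Hom[OF Y(1) f]] .
    show "\<phi> Y' X (f \<cdot>\<^bsub>D\<^esub> ArrMap L u) = \<phi> Y X f \<cdot>\<^bsub>C\<^esub> u"
      using nat[OF Y X X u f D.Id_Hom[OF X]] D.Id_Comp[OF fu] C.Id_Comp[OF pu]
        additive_functor_Id[OF R X] by simp
  next
    fix Y f X v X' assume Y: "Y \<in> Obj C" and f: "f \<in> Hom D (ObjMap L Y) X" and v: "v \<in> Hom D X X'"
    have X: "X \<in> Obj D" "X' \<in> Obj D" using D.Hom_Obj[OF v] by blast+
    show "\<phi> Y X' (v \<cdot>\<^bsub>D\<^esub> f) = ArrMap R v \<cdot>\<^bsub>C\<^esub> \<phi> Y X f"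
      using nat[OF Y Y X C.Id_Hom[OF Y] f v] D.Comp_Id[OF f] C.Comp_Id[OF Hom[OF Y f]]
        additive_functor_Id[OF L Y] by simp
  qed
  then show thesis by (rule that)
qed

text \<open>A family of arrows from the \<open>L (X i)\<close> to \<open>S\<close> transposes to a
  family from the \<open>X i\<close> to \<open>R S\<close>; the unique arrow from \<open>T\<close>
  that it induces transposes back.\<close>

lemma left_adjoint_coproduct:
  assumes "category C" "category D" and adj: "is_right_adjoint C D L R"
    and T: "is_coproduct C I X T inc"
  shows "is_coproduct D I (\<lambda>i. ObjMap L (X i)) (ObjMap L T) (\<lambda>i. ArrMap L (inc i))"
proof -
  interpret C: category C by fact
  interpret D: category D by fact
  have L: "additive_functor C D L" and R: "additive_functor D C R"
    using adj by (auto simp: is_right_adjoint_def)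
  have TO: "T \<in> Obj C" and inc: "\<And>i. i \<in> I \<Longrightarrow> inc i \<in> Hom C (X i) T"
    and univ: "\<And>S f. \<lbrakk>S \<in> Obj C; \<forall>i \<in> I. f i \<in> Hom C (X i) S\<rbrakk>
      \<Longrightarrow> \<exists>!h. h \<in> Hom C T S \<and> (\<forall>i \<in> I. h \<cdot>\<^bsub>C\<^esub> inc i = f i)"
    using T by (auto simp: is_coproduct_def)
  have XO: "X i \<in> Obj C" if "i \<in> I" for i using C.Hom_Obj(1)[OF inc[OF that]] .
  obtain \<phi> where "hom_bijection C D L R \<phi>" using right_adjoint_hom_bijection assms(1-3) by blast
  then interpret \<phi>: hom_bijection C D L R \<phi> .
  have "\<exists>!h. h \<in> Hom D (ObjMap L T) S \<and> (\<forall>i \<in> I. h \<cdot>\<^bsub>D\<^esub> ArrMap L (inc i) = f i)"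
    if S: "S \<in> Obj D" and f: "\<forall>i \<in> I. f i \<in> Hom D (ObjMap L (X i)) S" for S f
  proof -
    have "\<forall>i \<in> I. \<phi> (X i) S (f i) \<in> Hom C (X i) (ObjMap R S)" using f \<phi>.Hom XO by blast
    from univ[OF additive_functor_Obj[OF R S] this]
    obtain h where h: "h \<in> Hom C T (ObjMap R S)" "\<forall>i \<in> I. h \<cdot>\<^bsub>C\<^esub> inc i = \<phi> (X i) S (f i)"
      and h_unique: "\<And>h'. \<lbrakk>h' \<in> Hom C T (ObjMap R S); \<forall>i \<in> I. h' \<cdot>\<^bsub>C\<^esub> inc i = \<phi> (X i) S (f i)\<rbrakk>
        \<Longrightarrow> h' = h"
      by blast
    obtain g where g: "g \<in> Hom D (ObjMap L T) S" "\<phi> T S g = h" using \<phi>.surj[OF S h(1)] by blast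
    have iff: "g' \<cdot>\<^bsub>D\<^esub> ArrMap L (inc i) = f i \<longleftrightarrow> \<phi> T S g' \<cdot>\<^bsub>C\<^esub> inc i = \<phi> (X i) S (f i)"
      if g': "g' \<in> Hom D (ObjMap L T) S" and i: "i \<in> I" for g' i
    proof -
      have g'i: "g' \<cdot>\<^bsub>D\<^esub> ArrMap L (inc i) \<in> Hom D (ObjMap L (X i)) S"
        using D.Comp_Hom[OF additive_functor_Hom[OF L inc[OF i]] g'] .
      have fi: "f i \<in> Hom D (ObjMap L (X i)) S" using f i by blast
      show ?thesis
        using \<phi>.inj[OF XO[OF i] g'i fi] unfolding \<phi>.natural_left[OF inc[OF i] g', symmetric]
        by metis
    qed
    show ?thesis
    proof (intro ex1I[of _ g] conjI g(1))
      show "\<forall>i\<in>I. g \<cdot>\<^bsub>D\<^esub> ArrMap L (inc i) = f i" using iff[OF g(1)] g(2) h(2) by simp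
      fix g' assume "g' \<in> Hom D (ObjMap L T) S \<and> (\<forall>i\<in>I. g' \<cdot>\<^bsub>D\<^esub> ArrMap L (inc i) = f i)"
      then have g': "g' \<in> Hom D (ObjMap L T) S" "\<forall>i\<in>I. g' \<cdot>\<^bsub>D\<^esub> ArrMap L (inc i) = f i" by blast+
      then have "\<phi> T S g' = h" using h_unique[OF \<phi>.Hom[OF TO g'(1)]] iff[OF g'(1)] by simp
      then show "g' = g" using \<phi>.inj[OF TO g'(1) g(1)] g(2) by simp
    qed
  qed
  then show ?thesis
    unfolding is_coproduct_def
    using additive_functor_Obj[OF L TO] additive_functor_Hom[OF L inc] by simp
qed

section \<open>Wide Morita contexts with right adjoints\<close>

locale wide_morita_adjoints =
  fixes \<kappa> :: "'k rel"
    and A :: "('a, 'm) precat" and B :: "('b, 'n) precat"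
    and F :: "('b, 'n, 'a, 'm) func" and G :: "('a, 'm, 'b, 'n) func"
    and F' :: "('a, 'm, 'b, 'n) func" and G' :: "('b, 'n, 'a, 'm) func"
    and \<eta> :: "'a \<Rightarrow> 'm" and \<rho> :: "'b \<Rightarrow> 'n"
  assumes morita: "right_wide_morita_context A B F G \<eta> \<rho>"
    and adjoint_F: "is_right_adjoint B A F F'" and adjoint_G: "is_right_adjoint A B G G'"
begin

sublocale A: abelian_category A using morita by (simp add: right_wide_morita_context_def)
sublocale B: abelian_category B using morita by (simp add: right_wide_morita_context_def)

text \<open>The two compatibility identities trade places when the categories do. Every result on
  \<open>\<eta>\<close>, \<open>F\<close> and \<open>F'\<close> therefore has a twin for
  \<open>\<rho>\<close>, \<open>G\<close> and \<open>G'\<close>.\<close>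

lemma swap: "wide_morita_adjoints B A G F G' F' \<rho> \<eta>"
  using morita adjoint_F adjoint_G
  by (simp add: wide_morita_adjoints_def right_wide_morita_context_def)

lemma right_exact: "right_exact_functor B A F" "right_exact_functor A B G"
  using morita by (simp_all add: right_wide_morita_context_def)

lemma additive_F: "additive_functor B A F" and additive_G: "additive_functor A B G"
  and additive_F': "additive_functor A B F'" and additive_G': "additive_functor B A G'"
  using adjoint_F adjoint_G by (simp_all add: is_right_adjoint_def)

lemmas F_Hom = additive_functor_Hom[OF additive_F]
lemmas G_Hom = additive_functor_Hom[OF additive_G]
lemmas F'_Hom = additive_functor_Hom[OF additive_F']
lemmas G'_Hom = additive_functor_Hom[OF additive_G']
lemmas F_Obj = additive_functor_Obj[OF additive_F]
lemmas G_Obj = additive_functor_Obj[OF additive_G]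
lemmas F'_Obj = additive_functor_Obj[OF additive_F']
lemmas G'_Obj = additive_functor_Obj[OF additive_G']
lemmas F_Comp = additive_functor_Comp[OF additive_F]
lemmas G_Comp = additive_functor_Comp[OF additive_G]
lemmas F_Zero =
  additive_functor_Zero[OF B.preadditive_category_axioms A.preadditive_category_axioms additive_F]
lemmas G_Zero =
  additive_functor_Zero[OF A.preadditive_category_axioms B.preadditive_category_axioms additive_G]

lemma eta_Hom: "X \<in> Obj A \<Longrightarrow> \<eta> X \<in> Hom A (ObjMap F (ObjMap G X)) X"
  using morita
  by (simp add: right_wide_morita_context_def natural_transformation_def comp_func_def id_func_def)

lemma rho_Hom: "Y \<in> Obj B \<Longrightarrow> \<rho> Y \<in> Hom B (ObjMap G (ObjMap F Y)) Y"
  using morita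
  by (simp add: right_wide_morita_context_def natural_transformation_def comp_func_def id_func_def)

lemma eta_natural: "f \<in> Hom A X Y \<Longrightarrow> \<eta> Y \<cdot>\<^bsub>A\<^esub> ArrMap F (ArrMap G f) = f \<cdot>\<^bsub>A\<^esub> \<eta> X"
  using morita
  by (simp add: right_wide_morita_context_def natural_transformation_def comp_func_def id_func_def)

lemma rho_natural: "f \<in> Hom B X Y \<Longrightarrow> \<rho> Y \<cdot>\<^bsub>B\<^esub> ArrMap G (ArrMap F f) = f \<cdot>\<^bsub>B\<^esub> \<rho> X"
  using morita
  by (simp add: right_wide_morita_context_def natural_transformation_def comp_func_def id_func_def)

lemma G_eta: "X \<in> Obj A \<Longrightarrow> ArrMap G (\<eta> X) = \<rho> (ObjMap G X)"
  using morita by (simp add: right_wide_morita_context_def)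

lemma F_rho: "Y \<in> Obj B \<Longrightarrow> ArrMap F (\<rho> Y) = \<eta> (ObjMap F Y)"
  using morita by (simp add: right_wide_morita_context_def)

section \<open>Annihilated objects as kernels and cokernels\<close>

text \<open>Testing with the identity gives one direction. Conversely, naturality moves
  \<open>f\<close> to the other side of \<open>\<eta>\<close>, where it meets
  \<open>\<eta> X\<close>.\<close>

lemma annihilated_iff:
  "X \<in> annihilated A \<eta> \<longleftrightarrow> X \<in> Obj A \<and> \<eta> X = Zero A (ObjMap F (ObjMap G X)) X"
proof (intro iffI conjI)
  assume X: "X \<in> annihilated A \<eta>"
  then show O: "X \<in> Obj A" by (simp add: annihilated_def)
  have "Id A X \<cdot>\<^bsub>A\<^esub> \<eta> X = Zero A (Dom A (\<eta> X)) X"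
    using X A.Id_Hom[OF O] by (simp add: annihilated_def)
  then show "\<eta> X = Zero A (ObjMap F (ObjMap G X)) X"
    using A.Id_Comp[OF eta_Hom[OF O]] HomD(2)[OF eta_Hom[OF O]] by simp
next
  assume X: "X \<in> Obj A \<and> \<eta> X = Zero A (ObjMap F (ObjMap G X)) X"
  have "f \<cdot>\<^bsub>A\<^esub> \<eta> M = Zero A (Dom A (\<eta> M)) X" if M: "M \<in> Obj A" and f: "f \<in> Hom A M X" for M f
    using eta_natural[OF f] A.Zero_Comp[OF F_Hom[OF G_Hom[OF f]]] X HomD(2)[OF eta_Hom[OF M]]
    by simp
  then show "X \<in> annihilated A \<eta>" using X by (simp add: annihilated_def)
qed

lemma rho_annihilated_iff:
  "Y \<in> annihilated B \<rho> \<longleftrightarrow> Y \<in> Obj B \<and> \<rho> Y = Zero B (ObjMap G (ObjMap F Y)) Y"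
  using wide_morita_adjoints.annihilated_iff[OF swap] .

text \<open>Both identities of the context enter: at \<open>FGX\<close> the arrow
  \<open>\<eta>\<close> equals \<open>FG (\<eta> X)\<close>. So \<open>k \<cdot> \<eta> K\<close> is
  the image under \<open>FG\<close> of \<open>\<eta> X \<cdot> k = 0\<close>, and \<open>k\<close>
  is monic.\<close>

lemma kernel_eta_annihilated:
  assumes X: "X \<in> Obj A" and k: "is_kernel A (\<eta> X) k" "k \<in> Hom A K (ObjMap F (ObjMap G X))"
  shows "K \<in> annihilated A \<eta>"
proof -
  note e = eta_Hom[OF X]
  have K: "K \<in> Obj A" using A.Hom_Obj k by blast
  have "k \<cdot>\<^bsub>A\<^esub> \<eta> K = ArrMap F (ArrMap G (\<eta> X)) \<cdot>\<^bsub>A\<^esub> ArrMap F (ArrMap G k)"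
    using eta_natural[OF k(2)] F_rho[OF G_Obj[OF X]] G_eta[OF X] by simp
  also have "\<dots> = ArrMap F (ArrMap G (\<eta> X \<cdot>\<^bsub>A\<^esub> k))"
    using F_Comp[OF G_Hom[OF k(2)] G_Hom[OF e]] G_Comp[OF k(2) e] by simp
  also have "\<dots> = Zero A (ObjMap F (ObjMap G K)) (ObjMap F (ObjMap G X))"
    using A.kernel_zero[OF k(1) e k(2)] G_Zero[OF K X] F_Zero[OF G_Obj[OF K] G_Obj[OF X]] by simp
  finally show ?thesis
    using A.mono_zero_cancel[OF A.kernel_mono[OF k(1) e k(2)] k(2) eta_Hom[OF K]] K
    by (simp add: annihilated_iff)
qed

text \<open>By naturality \<open>\<eta> Q\<close> composed with \<open>FG c\<close> is
  \<open>c \<cdot> \<eta> X = 0\<close>, and \<open>FG c\<close> is epic by right exactness.\<close>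

lemma cokernel_eta_annihilated:
  assumes X: "X \<in> Obj A" and c: "is_cokernel A (\<eta> X) c" "c \<in> Hom A X Q"
  shows "Q \<in> annihilated A \<eta>"
proof -
  have Q: "Q \<in> Obj A" using A.Hom_Obj c by blast
  have "epi_arr A c" using A.cokernel_epi[OF c(1) eta_Hom[OF X] c(2)] .
  then have epi: "epi_arr A (ArrMap F (ArrMap G c))"
    using right_exact_epi[OF B.abelian_category_axioms A.abelian_category_axioms right_exact(1)]
      right_exact_epi[OF A.abelian_category_axioms B.abelian_category_axioms right_exact(2)]
      G_Hom c(2) by blast
  show ?thesis
    using A.epi_zero_cancel[OF epi F_Hom[OF G_Hom[OF c(2)]] eta_Hom[OF Q]] eta_natural[OF c(2)]
      A.cokernel_zero[OF c(1) eta_Hom[OF X] c(2)] Q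
    by (simp add: annihilated_iff)
qed

text \<open>This measures how far \<open>F\<close> is from being left exact. Naturality of
  \<open>\<rho>\<close> shows that \<open>m\<close> kills \<open>\<rho> N' \<cdot> G k\<close>, so
  that arrow is zero. Applying \<open>F\<close> and using \<open>F \<rho> = \<eta> F\<close> yields
  \<open>k \<cdot> \<eta> K = 0\<close>.\<close>

lemma kernel_F_mono_annihilated:
  assumes m: "mono_arr B m" "m \<in> Hom B N' N"
    and k: "is_kernel A (ArrMap F m) k" "k \<in> Hom A K (ObjMap F N')"
  shows "K \<in> annihilated A \<eta>"
proof -
  have O: "N' \<in> Obj B" "N \<in> Obj B" using B.Hom_Obj[OF m(2)] by blast+
  have K: "K \<in> Obj A" using A.Hom_Obj[OF k(2)] by blast
  note r = rho_Hom[OF O(1)] rho_Hom[OF O(2)] and Gk = G_Hom[OF k(2)] and Fm = F_Hom[OF m(2)]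
  have rk: "\<rho> N' \<cdot>\<^bsub>B\<^esub> ArrMap G k \<in> Hom B (ObjMap G K) N'" using B.Comp_Hom[OF Gk r(1)] .
  have "m \<cdot>\<^bsub>B\<^esub> (\<rho> N' \<cdot>\<^bsub>B\<^esub> ArrMap G k) = (\<rho> N \<cdot>\<^bsub>B\<^esub> ArrMap G (ArrMap F m)) \<cdot>\<^bsub>B\<^esub> ArrMap G k"
    using B.Comp_assoc[OF Gk r(1) m(2)] rho_natural[OF m(2)] by simp
  also have "\<dots> = \<rho> N \<cdot>\<^bsub>B\<^esub> ArrMap G (ArrMap F m \<cdot>\<^bsub>A\<^esub> k)"
    using B.Comp_assoc[OF Gk G_Hom[OF Fm] r(2)] G_Comp[OF k(2) Fm] by simp
  also have "\<dots> = Zero B (ObjMap G K) N"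
    using A.kernel_zero[OF k(1) Fm k(2)] G_Zero[OF K F_Obj[OF O(2)]] B.Comp_Zero[OF r(2) G_Obj[OF K]]
    by simp
  finally have "\<rho> N' \<cdot>\<^bsub>B\<^esub> ArrMap G k = Zero B (ObjMap G K) N'"
    using B.mono_zero_cancel[OF m rk] by simp
  then have "ArrMap F (\<rho> N') \<cdot>\<^bsub>A\<^esub> ArrMap F (ArrMap G k) = Zero A (ObjMap F (ObjMap G K)) (ObjMap F N')"
    using F_Comp[OF Gk r(1)] F_Zero[OF G_Obj[OF K] O(1)] by simp
  then have "k \<cdot>\<^bsub>A\<^esub> \<eta> K = Zero A (ObjMap F (ObjMap G K)) (ObjMap F N')"
    using eta_natural[OF k(2)] F_rho[OF O(1)] by simp
  then show ?thesis
    using A.mono_zero_cancel[OF A.kernel_mono[OF k(1) Fm k(2)] k(2) eta_Hom[OF K]] K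
    by (simp add: annihilated_iff)
qed

text \<open>Quotients and extensions use right exactness of \<open>F\<close>, coproducts its right
  adjoint. Subobjects are the delicate case: the kernel of \<open>F m\<close> need not vanish, but
  it is annihilated and hence in \<open>L\<close>.\<close>

lemma localizing_preimage_F:
  assumes L: "localizing_subcategory \<kappa> A L" and ann: "annihilated A \<eta> \<subseteq> L"
  shows "localizing_subcategory \<kappa> B {N \<in> Obj B. ObjMap F N \<in> L}"
proof -
  note cl = localizing_closed[OF L]
  have "ObjMap F (Dom B m) \<in> L" if m: "mono_arr B m" and N: "ObjMap F (Cod B m) \<in> L" for m
  proof -
    have mH: "m \<in> Hom B (Dom B m) (Cod B m)" using m by (simp add: mono_arr_def ArrD)
    obtain K k where k: "is_kernel A (ArrMap F m) k" "k \<in> Hom A K (ObjMap F (Dom B m))"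
      using A.obtain_kernel[OF F_Hom[OF mH]] by blast
    obtain I e i where ei: "e \<in> Hom A (ObjMap F (Dom B m)) I" "i \<in> Hom A I (ObjMap F (Cod B m))"
      "mono_arr A i" "is_cokernel A k e"
      using A.epi_mono_factorization[OF F_Hom[OF mH] k] by blast
    \<comment> \<open>The object \<open>F N'\<close> is an extension of the image \<open>I\<close>
      of \<open>F m\<close> by the kernel \<open>K\<close>.\<close>
    have "K \<in> L" using kernel_F_mono_annihilated[OF m mH k] ann by blast
    moreover have "I \<in> L" using closed_subcategory_sub[OF cl ei(3,2) N] .
    moreover have "short_exact A k e"
      using A.mono_cokernel_short_exact[OF A.kernel_mono[OF k(1) F_Hom[OF mH] k(2)] ei(4) k(2) ei(1)] .
    ultimately show ?thesis using localizing_subcategory_extension[OF L _ k(2) ei(1)] by blast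
  qed
  moreover have "Dom B m \<in> Obj B" if "mono_arr B m" for m
    using that B.Dom_Obj by (simp add: mono_arr_def)
  moreover have "ObjMap F (Cod B e) \<in> L" if e: "epi_arr B e" and N: "ObjMap F (Dom B e) \<in> L" for e
  proof -
    have eH: "e \<in> Hom B (Dom B e) (Cod B e)" using e by (simp add: epi_arr_def ArrD)
    have "epi_arr A (ArrMap F e)"
      using right_exact_epi[OF B.abelian_category_axioms A.abelian_category_axioms right_exact(1) e eH] .
    then show ?thesis using closed_subcategory_quotient[OF cl _ F_Hom[OF eH] N] by blast
  qed
  moreover have "Cod B e \<in> Obj B" if "epi_arr B e" for e
    using that B.Cod_Obj by (simp add: epi_arr_def)
  moreover have "ObjMap F T \<in> L"
    if "small \<kappa> I" "\<forall>i \<in> I. X i \<in> {N \<in> Obj B. ObjMap F N \<in> L}" and T: "is_coproduct B I X T inc"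
    for I :: "'k set" and X T inc
  proof -
    have cop: "is_coproduct A I (\<lambda>i. ObjMap F (X i)) (ObjMap F T) (\<lambda>i. ArrMap F (inc i))"
      using left_adjoint_coproduct[OF B.category_axioms A.category_axioms adjoint_F T] .
    show ?thesis by (rule closed_subcategory_coproduct[OF cl that(1) _ cop]) (use that in blast)
  qed
  moreover have "T \<in> Obj B" if "is_coproduct B I X T inc" for I :: "'k set" and X T inc
    using that by (simp add: is_coproduct_def)
  moreover have "ObjMap F (Cod B f) \<in> L"
    if fg: "short_exact B f g" and N: "ObjMap F (Dom B f) \<in> L" "ObjMap F (Cod B g) \<in> L" for f g
  proof -
    have fH: "f \<in> Hom B (Dom B f) (Cod B f)" using fg by (simp add: short_exact_def mono_arr_def ArrD)
    have "Dom B g = Cod B f"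
      using fg by (auto simp: short_exact_def exact_def is_cokernel_def is_kernel_def)
    then have gH: "g \<in> Hom B (Cod B f) (Cod B g)"
      using fg by (simp add: short_exact_def epi_arr_def Hom_def)
    have "is_cokernel B f g" using B.exact_epi_cokernel[OF _ _ fH gH] fg by (simp add: short_exact_def)
    then have cok: "is_cokernel A (ArrMap F f) (ArrMap F g)"
      using right_exact_cokernel[OF B.abelian_category_axioms A.abelian_category_axioms right_exact(1)
          _ fH gH] by blast
    obtain K k where k: "is_kernel A (ArrMap F f) k" "k \<in> Hom A K (ObjMap F (Dom B f))"
      using A.obtain_kernel[OF F_Hom[OF fH]] by blast
    obtain I e i where ei: "e \<in> Hom A (ObjMap F (Dom B f)) I" "i \<in> Hom A I (ObjMap F (Cod B f))"
      "i \<cdot>\<^bsub>A\<^esub> e = ArrMap F f" "epi_arr A e" "mono_arr A i"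
      using A.epi_mono_factorization[OF F_Hom[OF fH] k] by blast
    \<comment> \<open>The arrow \<open>F f\<close> may fail to be monic; its image \<open>i\<close>
      is monic and has the same cokernel.\<close>
    have "is_cokernel A i (ArrMap F g)"
      using A.cokernel_cancel_epi[OF _ ei(4,1,2) F_Hom[OF gH]] cok ei(3) by simp
    then have "short_exact A i (ArrMap F g)"
      using A.mono_cokernel_short_exact[OF ei(5) _ ei(2) F_Hom[OF gH]] by blast
    moreover have "I \<in> L" using closed_subcategory_quotient[OF cl ei(4,1) N(1)] .
    ultimately show ?thesis
      using localizing_subcategory_extension[OF L _ ei(2) F_Hom[OF gH]] N(2) by blast
  qed
  moreover have "Cod B f \<in> Obj B" if "short_exact B f g" for f g
    using that B.Cod_Obj by (simp add: short_exact_def mono_arr_def)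
  ultimately show ?thesis
    unfolding localizing_subcategory_def closed_subcategory_def by blast
qed

section \<open>The localizing closures under \<open>F\<close> and \<open>F'\<close>\<close>

abbreviation "\<C> \<equiv> localizing_closure \<kappa> A (annihilated A \<eta>)"
abbreviation "\<D> \<equiv> localizing_closure \<kappa> B (annihilated B \<rho>)"

lemma localizing_C: "localizing_subcategory \<kappa> A \<C>"
  by (rule A.localizing_closure_localizing) (auto simp: annihilated_def)

lemma annihilated_C: "X \<in> annihilated A \<eta> \<Longrightarrow> X \<in> \<C>"
  using localizing_closure_superset by (rule subsetD)

text \<open>From \<open>F \<rho> = \<eta> F\<close>, \<open>F\<close> sends annihilated objects to
  annihilated ones. Hence the preimage of \<open>\<C>\<close> under \<open>F\<close> is a localizing
  subcategory containing them, and minimality of \<open>\<D>\<close> applies.\<close>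

lemma F_closure:
  assumes "N \<in> \<D>"
  shows "N \<in> Obj B" "ObjMap F N \<in> \<C>"
proof -
  have "ObjMap F Y \<in> annihilated A \<eta>" if Y: "Y \<in> annihilated B \<rho>" for Y
  proof -
    have O: "Y \<in> Obj B" and z: "\<rho> Y = Zero B (ObjMap G (ObjMap F Y)) Y"
      using Y by (simp_all add: rho_annihilated_iff)
    show ?thesis
      using F_rho[OF O] z F_Zero[OF G_Obj[OF F_Obj[OF O]] O] F_Obj[OF O]
      by (simp add: annihilated_iff)
  qed
  then have "annihilated B \<rho> \<subseteq> {N \<in> Obj B. ObjMap F N \<in> \<C>}"
    using annihilated_C by (auto simp: annihilated_def)
  then have "\<D> \<subseteq> {N \<in> Obj B. ObjMap F N \<in> \<C>}"
    using localizing_preimage_F[OF localizing_C localizing_closure_superset]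
    by (rule localizing_closure_least[rotated])
  then show "N \<in> Obj B" "ObjMap F N \<in> \<C>" using assms by blast+
qed

text \<open>Arrows from \<open>N\<close> to \<open>F' X\<close> are arrows from \<open>F N\<close>
  to \<open>X\<close>. Since \<open>F\<close> maps \<open>\<D>\<close> into \<open>\<C>\<close> and
  is exact modulo \<open>\<C>\<close>, both conditions on \<open>F' X\<close> reduce to those on
  \<open>X\<close>.\<close>

lemma F'_closed:
  assumes X: "X \<in> closed_objects A \<C>"
  shows "ObjMap F' X \<in> closed_objects B \<D>"
proof -
  note cl = localizing_closed[OF localizing_C]
  have XO: "X \<in> Obj A" and Xt: "torsion_free A \<C> X" using X by (simp_all add: closed_objects_def)
  obtain \<phi> where "hom_bijection B A F F' \<phi>"
    using right_adjoint_hom_bijection[OF B.category_axioms A.category_axioms adjoint_F] by blast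
  then interpret \<phi>: hom_bijection B A F F' \<phi> .
  \<comment> \<open>The transposes of \<open>f\<close> and \<open>g\<close> start at
    \<open>F N\<close>, which is in \<open>\<C>\<close>, so both are zero.\<close>
  have Hom_eq: "f = g"
    if N: "N \<in> \<D>" and f: "f \<in> Hom B N (ObjMap F' X)" and g: "g \<in> Hom B N (ObjMap F' X)" for N f g
    using \<phi>.surj[OF XO f] \<phi>.surj[OF XO g] A.torsion_free_zero[OF cl Xt _ F_closure(2)[OF N]] by metis
  have "zero_object B (Dom B m)"
    if m: "mono_arr B m" "Dom B m \<in> \<D>" "Cod B m = ObjMap F' X" for m
  proof (rule B.zero_objectI)
    have mH: "m \<in> Hom B (Dom B m) (ObjMap F' X)" using m by (simp add: mono_arr_def Hom_def)
    show O: "Dom B m \<in> Obj B" using B.Hom_Obj(1)[OF mH] .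
    \<comment> \<open>By \<open>Hom_eq\<close>, \<open>m\<close> itself is the zero arrow; being
      monic, it forces the identity of its domain to be zero.\<close>
    show "Id B (Dom B m) = Zero B (Dom B m) (Dom B m)"
      using B.mono_zero_cancel[OF m(1) mH B.Id_Hom[OF O]]
        Hom_eq[OF m(2) B.Comp_Hom[OF B.Id_Hom[OF O] mH] B.Zero_Hom[OF O F'_Obj[OF XO]]]
      by blast
  qed
  then have tf: "torsion_free B \<D> (ObjMap F' X)" by (simp add: torsion_free_def)
  have "\<exists>g \<in> Hom B (Cod B i) (ObjMap F' X). g \<cdot>\<^bsub>B\<^esub> i = f"
    if i: "mono_arr B i" "is_cokernel B i c" "Cod B c \<in> \<D>" and f: "f \<in> Hom B (Dom B i) (ObjMap F' X)"
    for i c f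
  proof -
    define N' N Q where "N' = Dom B i" and "N = Cod B i" and "Q = Cod B c"
    have iH: "i \<in> Hom B N' N" using i by (simp add: mono_arr_def Hom_def N'_def N_def)
    have cH: "c \<in> Hom B N Q" using i(2) by (simp add: is_cokernel_def Hom_def Q_def N_def)
    obtain f1 where f1: "f1 \<in> Hom A (ObjMap F N') X" "\<phi> N' X f1 = f"
      using \<phi>.surj[OF XO f] by (auto simp: N'_def)
    obtain K k where k: "is_kernel A (ArrMap F i) k" "k \<in> Hom A K (ObjMap F N')"
      using A.obtain_kernel[OF F_Hom[OF iH]] by blast
    have K: "K \<in> \<C>" using kernel_F_mono_annihilated[OF i(1) iH k] annihilated_C by blast
    \<comment> \<open>With kernel and cokernel of \<open>F i\<close> in \<open>\<C>\<close>, the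
      transpose \<open>f1\<close> extends along \<open>F i\<close> although \<open>F i\<close> need
      not be monic.\<close>
    have "is_cokernel A (ArrMap F i) (ArrMap F c)"
      using right_exact_cokernel[OF B.abelian_category_axioms A.abelian_category_axioms right_exact(1)
          i(2) iH cH] .
    then obtain g where g: "g \<in> Hom A (ObjMap F N) X" "g \<cdot>\<^bsub>A\<^esub> ArrMap F i = f1"
      using A.closed_object_extend[OF cl X F_Hom[OF iH] k K _ F_Hom[OF cH] _ f1(1)]
        F_closure(2)[OF i(3)] by (auto simp: Q_def)
    have "\<phi> N X g \<cdot>\<^bsub>B\<^esub> i = f" using \<phi>.natural_left[OF iH g(1)] g(2) f1(2) by simp
    then show ?thesis using \<phi>.Hom[OF B.Hom_Obj(2)[OF iH] g(1)] by (auto simp: N_def)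
  qed
  then have "relatively_injective B \<D> (ObjMap F' X)" unfolding relatively_injective_def by blast
  with tf F'_Obj[OF XO] show ?thesis by (simp add: closed_objects_def)
qed

text \<open>
  The arrow \<open>u X\<close> is the transpose of \<open>\<eta> X\<close> under \<open>FG \<stileturn> G'F'\<close>, so composition with it is the map
  \<open>Hom(M, X) \<rightarrow> Hom(FGM, X)\<close> given by composition with \<open>\<eta> M\<close>, up to transposition. For closed \<open>X\<close>
  this is bijective, since the kernel and the cokernel of \<open>\<eta> M\<close> are in \<open>\<C>\<close>.
\<close>

lemma unit_exists:
  obtains u where
    "\<And>X. X \<in> Obj A \<Longrightarrow> u X \<in> Hom A X (ObjMap G' (ObjMap F' X))"
    "\<And>X Y f. f \<in> Hom A X Y \<Longrightarrow> ArrMap G' (ArrMap F' f) \<cdot>\<^bsub>A\<^esub> u X = u Y \<cdot>\<^bsub>A\<^esub> f"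
    "\<And>X. X \<in> closed_objects A \<C> \<Longrightarrow> \<exists>t \<in> Hom A (ObjMap G' (ObjMap F' X)) X.
      u X \<cdot>\<^bsub>A\<^esub> t = Id A (ObjMap G' (ObjMap F' X)) \<and> t \<cdot>\<^bsub>A\<^esub> u X = Id A X"
proof -
  note cl = localizing_closed[OF localizing_C]
  obtain \<phi> where "hom_bijection B A F F' \<phi>"
    using right_adjoint_hom_bijection[OF B.category_axioms A.category_axioms adjoint_F] by blast
  then interpret \<phi>: hom_bijection B A F F' \<phi> .
  obtain \<gamma> where "hom_bijection A B G G' \<gamma>"
    using right_adjoint_hom_bijection[OF A.category_axioms B.category_axioms adjoint_G] by blast
  then interpret \<gamma>: hom_bijection A B G G' \<gamma> .
  \<comment> \<open>The bijection of the composite adjunction: first transpose from \<open>F\<close>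
    to \<open>F'\<close> at \<open>G M\<close>, then from \<open>G\<close> to
    \<open>G'\<close>.\<close>
  define \<psi> where "\<psi> M X f = \<gamma> M (ObjMap F' X) (\<phi> (ObjMap G M) X f)" for M X f
  define u where "u X = \<psi> X X (\<eta> X)" for X
  have \<psi>_Hom: "\<psi> M X f \<in> Hom A M (ObjMap G' (ObjMap F' X))"
    if "M \<in> Obj A" "f \<in> Hom A (ObjMap F (ObjMap G M)) X" for M X f
    using \<gamma>.Hom[OF that(1) \<phi>.Hom[OF G_Obj[OF that(1)] that(2)]] by (simp add: \<psi>_def)
  have inj: "f = g"
    if "M \<in> Obj A" "f \<in> Hom A (ObjMap F (ObjMap G M)) X" "g \<in> Hom A (ObjMap F (ObjMap G M)) X"
      "\<psi> M X f = \<psi> M X g" for M X f g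
    using \<phi>.inj[OF G_Obj[OF that(1)] that(2,3)]
      \<gamma>.inj[OF that(1) \<phi>.Hom[OF G_Obj[OF that(1)] that(2)] \<phi>.Hom[OF G_Obj[OF that(1)] that(3)]] that(4)
    by (simp add: \<psi>_def)
  have surj: "\<exists>f \<in> Hom A (ObjMap F (ObjMap G M)) X. \<psi> M X f = h"
    if "X \<in> Obj A" "h \<in> Hom A M (ObjMap G' (ObjMap F' X))" for M X h
    using \<gamma>.surj[OF F'_Obj[OF that(1)] that(2)] \<phi>.surj[OF that(1)] unfolding \<psi>_def by metis
  \<comment> \<open>Naturality rewrites \<open>g \<cdot> \<eta> M\<close> as \<open>\<eta> X\<close>
    after \<open>FG g\<close>, so its transpose is that of \<open>\<eta> X\<close> precomposed with
    \<open>g\<close>.\<close>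
  have \<psi>_eta: "\<psi> M X (g \<cdot>\<^bsub>A\<^esub> \<eta> M) = u X \<cdot>\<^bsub>A\<^esub> g" if g: "g \<in> Hom A M X" for M X g
  proof -
    have X: "X \<in> Obj A" using A.Hom_Obj(2)[OF g] .
    have "\<phi> (ObjMap G M) X (g \<cdot>\<^bsub>A\<^esub> \<eta> M) = \<phi> (ObjMap G X) X (\<eta> X) \<cdot>\<^bsub>B\<^esub> ArrMap G g"
      using \<phi>.natural_left[OF G_Hom[OF g] eta_Hom[OF X]] eta_natural[OF g] by simp
    then show ?thesis
      using \<gamma>.natural_left[OF g \<phi>.Hom[OF G_Obj[OF X] eta_Hom[OF X]]] by (simp add: \<psi>_def u_def)
  qed
  show thesis
  proof (rule that[of u])
    show uH: "u X \<in> Hom A X (ObjMap G' (ObjMap F' X))" if "X \<in> Obj A" for X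
      using \<psi>_Hom[OF that eta_Hom[OF that]] by (simp add: u_def)
    show "ArrMap G' (ArrMap F' f) \<cdot>\<^bsub>A\<^esub> u X = u Y \<cdot>\<^bsub>A\<^esub> f" if f: "f \<in> Hom A X Y" for X Y f
    proof -
      have X: "X \<in> Obj A" using A.Hom_Obj(1)[OF f] .
      have "\<psi> X Y (f \<cdot>\<^bsub>A\<^esub> \<eta> X) = ArrMap G' (ArrMap F' f) \<cdot>\<^bsub>A\<^esub> u X"
        using \<phi>.natural_right[OF G_Obj[OF X] eta_Hom[OF X] f]
          \<gamma>.natural_right[OF X \<phi>.Hom[OF G_Obj[OF X] eta_Hom[OF X]] F'_Hom[OF f]]
        by (simp add: \<psi>_def u_def)
      then show ?thesis using \<psi>_eta[OF f] by simp
    qed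
    fix X assume X: "X \<in> closed_objects A \<C>"
    then have XO: "X \<in> Obj A" by (simp add: closed_objects_def)
    define W where "W = ObjMap G' (ObjMap F' X)"
    have W: "W \<in> Obj A" using G'_Obj[OF F'_Obj[OF XO]] by (simp add: W_def)
    have uX: "u X \<in> Hom A X W" using uH[OF XO] by (simp add: W_def)
    obtain K k where k: "is_kernel A (\<eta> W) k" "k \<in> Hom A K (ObjMap F (ObjMap G W))"
      using A.obtain_kernel[OF eta_Hom[OF W]] by blast
    obtain Q c where c: "is_cokernel A (\<eta> W) c" "c \<in> Hom A W Q"
      using A.obtain_cokernel[OF eta_Hom[OF W]] by blast
    \<comment> \<open>The candidate inverse comes from the Yoneda argument: \<open>f\<close> is the
      arrow with transpose the identity of \<open>W\<close>, and its extension \<open>t\<close>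
      along \<open>\<eta> W\<close> is a right inverse of \<open>u X\<close>.\<close>
    obtain f where f: "f \<in> Hom A (ObjMap F (ObjMap G W)) X" "\<psi> W X f = Id A W"
      using surj[OF XO, of "Id A W" W] A.Id_Hom[OF W] by (auto simp: W_def)
    obtain t where t: "t \<in> Hom A W X" "t \<cdot>\<^bsub>A\<^esub> \<eta> W = f"
      using A.closed_object_extend[OF cl X eta_Hom[OF W] k _ c _ f(1)]
        kernel_eta_annihilated[OF W k] cokernel_eta_annihilated[OF W c] annihilated_C by blast
    have ut: "u X \<cdot>\<^bsub>A\<^esub> t = Id A W" using \<psi>_eta[OF t(1)] t(2) f(2) by simp
    have tu: "t \<cdot>\<^bsub>A\<^esub> u X \<in> Hom A X X" using A.Comp_Hom[OF uX t(1)] .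
    \<comment> \<open>A right inverse is also a left inverse because \<open>u X\<close> can be
      cancelled: \<open>\<psi>\<close> is injective, and arrows into the closed object
      \<open>X\<close> are determined by their composites with \<open>\<eta> X\<close>.\<close>
    have "u X \<cdot>\<^bsub>A\<^esub> (t \<cdot>\<^bsub>A\<^esub> u X) = u X \<cdot>\<^bsub>A\<^esub> Id A X"
      using A.Comp_assoc[OF uX t(1) uX] ut A.Id_Comp[OF uX] A.Comp_Id[OF uX] by simp
    then have "\<psi> X X ((t \<cdot>\<^bsub>A\<^esub> u X) \<cdot>\<^bsub>A\<^esub> \<eta> X) = \<psi> X X (Id A X \<cdot>\<^bsub>A\<^esub> \<eta> X)"
      using \<psi>_eta[OF tu] \<psi>_eta[OF A.Id_Hom[OF XO]] by simp
    then have eq: "(t \<cdot>\<^bsub>A\<^esub> u X) \<cdot>\<^bsub>A\<^esub> \<eta> X = Id A X \<cdot>\<^bsub>A\<^esub> \<eta> X"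
      using inj[OF XO A.Comp_Hom[OF eta_Hom[OF XO] tu]
          A.Comp_Hom[OF eta_Hom[OF XO] A.Id_Hom[OF XO]]] by blast
    obtain Q' c' where c': "is_cokernel A (\<eta> X) c'" "c' \<in> Hom A X Q'"
      using A.obtain_cokernel[OF eta_Hom[OF XO]] by blast
    have "t \<cdot>\<^bsub>A\<^esub> u X = Id A X"
      using A.closed_object_cancel[OF cl X eta_Hom[OF XO] c' _ tu A.Id_Hom[OF XO] eq]
        cokernel_eta_annihilated[OF XO c'] annihilated_C by blast
    with ut t(1) show "\<exists>t \<in> Hom A (ObjMap G' (ObjMap F' X)) X.
        u X \<cdot>\<^bsub>A\<^esub> t = Id A (ObjMap G' (ObjMap F' X)) \<and> t \<cdot>\<^bsub>A\<^esub> u X = Id A X"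
      by (auto simp: W_def)
  qed
qed

end

section \<open>The equivalence\<close>

lemma quotient_category_simps:
  "Obj (quotient_category A L) = closed_objects A L"
  "Id (quotient_category A L) = Id A"
  "Comp (quotient_category A L) = Comp A"
  "Plus (quotient_category A L) = Plus A"
  by (simp_all add: quotient_category_def full_subcategory_def)

lemma Hom_quotient_category:
  "f \<in> Hom (quotient_category A L) X Y \<longleftrightarrow>
    X \<in> closed_objects A L \<and> Y \<in> closed_objects A L \<and> f \<in> Hom A X Y"
  by (auto simp: quotient_category_def full_subcategory_def Hom_def)

lemma iso_arr_quotient_category:
  assumes "X \<in> closed_objects A L" "Y \<in> closed_objects A L" "f \<in> Hom A X Y" "g \<in> Hom A Y X"
    "g \<cdot>\<^bsub>A\<^esub> f = Id A X" "f \<cdot>\<^bsub>A\<^esub> g = Id A Y"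
  shows "iso_arr (quotient_category A L) f"
proof -
  have f: "f \<in> Hom (quotient_category A L) X Y" and g: "g \<in> Hom (quotient_category A L) Y X"
    using assms by (simp_all add: Hom_quotient_category)
  show ?thesis
    unfolding iso_arr_def using f g assms(5,6) HomD[OF f] by (auto simp: quotient_category_simps)
qed

lemma additive_functor_quotient_category:
  assumes "additive_functor A B F"
    and "\<And>X. X \<in> closed_objects A L \<Longrightarrow> ObjMap F X \<in> closed_objects B M"
  shows "additive_functor (quotient_category A L) (quotient_category B M) F"
proof -
  have "X \<in> Obj A" if "X \<in> closed_objects A L" for X using that by (simp add: closed_objects_def)
  with assms show ?thesis
    unfolding additive_functor_def Hom_quotient_category quotient_category_simps Ball_def
    by (simp add: Hom_quotient_category) meson
qed

context wide_morita_adjoints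
begin

text \<open>The definition asks for arrows from \<open>G' F' X\<close> to \<open>X\<close>, opposite
  to the unit \<open>u\<close>. The inverses of the \<open>u X\<close> are used, and their
  naturality is that of \<open>u\<close> conjugated by them.\<close>

lemma quotient_unit_isomorphic:
  "naturally_isomorphic (quotient_category A \<C>) (quotient_category A \<C>) (G' \<odot> F') id_func"
proof -
  obtain u where uH: "\<And>X. X \<in> Obj A \<Longrightarrow> u X \<in> Hom A X (ObjMap G' (ObjMap F' X))"
    and unat: "\<And>X Y f. f \<in> Hom A X Y \<Longrightarrow> ArrMap G' (ArrMap F' f) \<cdot>\<^bsub>A\<^esub> u X = u Y \<cdot>\<^bsub>A\<^esub> f"
    and uiso: "\<And>X. X \<in> closed_objects A \<C> \<Longrightarrow> \<exists>t \<in> Hom A (ObjMap G' (ObjMap F' X)) X.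
      u X \<cdot>\<^bsub>A\<^esub> t = Id A (ObjMap G' (ObjMap F' X)) \<and> t \<cdot>\<^bsub>A\<^esub> u X = Id A X"
    using unit_exists by blast
  from uiso obtain \<tau> where t: "\<And>X. X \<in> closed_objects A \<C> \<Longrightarrow>
      \<tau> X \<in> Hom A (ObjMap G' (ObjMap F' X)) X \<and>
      u X \<cdot>\<^bsub>A\<^esub> \<tau> X = Id A (ObjMap G' (ObjMap F' X)) \<and> \<tau> X \<cdot>\<^bsub>A\<^esub> u X = Id A X"
    by metis
  have cO: "X \<in> Obj A" if "X \<in> closed_objects A \<C>" for X using that by (simp add: closed_objects_def)
  have GF: "ObjMap G' (ObjMap F' X) \<in> closed_objects A \<C>" if "X \<in> closed_objects A \<C>" for X
    using wide_morita_adjoints.F'_closed[OF swap F'_closed[OF that]] .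
  have "\<tau> Y \<cdot>\<^bsub>A\<^esub> ArrMap G' (ArrMap F' f) = f \<cdot>\<^bsub>A\<^esub> \<tau> X"
    if X: "X \<in> closed_objects A \<C>" and Y: "Y \<in> closed_objects A \<C>" and f: "f \<in> Hom A X Y" for X Y f
  proof -
    have tX: "\<tau> X \<in> Hom A (ObjMap G' (ObjMap F' X)) X"
        "u X \<cdot>\<^bsub>A\<^esub> \<tau> X = Id A (ObjMap G' (ObjMap F' X))"
      and tY: "\<tau> Y \<in> Hom A (ObjMap G' (ObjMap F' Y)) Y" "\<tau> Y \<cdot>\<^bsub>A\<^esub> u Y = Id A Y"
      using t X Y by blast+
    note uX = uH[OF cO[OF X]] and uY = uH[OF cO[OF Y]]
    have g: "ArrMap G' (ArrMap F' f) \<in> Hom A (ObjMap G' (ObjMap F' X)) (ObjMap G' (ObjMap F' Y))"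
      using G'_Hom[OF F'_Hom[OF f]] .
    have ft: "f \<cdot>\<^bsub>A\<^esub> \<tau> X \<in> Hom A (ObjMap G' (ObjMap F' X)) Y" using A.Comp_Hom[OF tX(1) f] .
    \<comment> \<open>Inserting \<open>u X \<cdot> \<tau> X\<close>, the identity, brings the
      naturality square of \<open>u\<close> into play; \<open>\<tau> Y\<close> then cancels
      \<open>u Y\<close>.\<close>
    have "ArrMap G' (ArrMap F' f) = (ArrMap G' (ArrMap F' f) \<cdot>\<^bsub>A\<^esub> u X) \<cdot>\<^bsub>A\<^esub> \<tau> X"
      using A.Comp_assoc[OF tX(1) uX g] tX(2) A.Comp_Id[OF g] by simp
    also have "\<dots> = u Y \<cdot>\<^bsub>A\<^esub> (f \<cdot>\<^bsub>A\<^esub> \<tau> X)" using A.Comp_assoc[OF tX(1) uX g] A.Comp_assoc[OF tX(1) f uY] unat[OF f] by simp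
    finally have "\<tau> Y \<cdot>\<^bsub>A\<^esub> ArrMap G' (ArrMap F' f) = (\<tau> Y \<cdot>\<^bsub>A\<^esub> u Y) \<cdot>\<^bsub>A\<^esub> (f \<cdot>\<^bsub>A\<^esub> \<tau> X)"
      using A.Comp_assoc[OF ft uY tY(1)] by simp
    then show ?thesis using tY A.Id_Comp[OF ft] by simp
  qed
  then have "natural_transformation (quotient_category A \<C>) (quotient_category A \<C>)
      (G' \<odot> F') id_func \<tau>"
    using t GF
    by (simp add: natural_transformation_def quotient_category_simps Hom_quotient_category
        comp_func_def id_func_def)
  moreover have "iso_arr (quotient_category A \<C>) (\<tau> X)" if X: "X \<in> closed_objects A \<C>" for X
    using iso_arr_quotient_category[OF GF[OF X] X _ uH[OF cO[OF X]]] t[OF X] by blast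
  ultimately show ?thesis unfolding naturally_isomorphic_def quotient_category_simps by blast
qed

end

theorem theorem5p3:
  fixes \<kappa> :: "'k rel"
    and A :: "('a, 'm) precat" and B :: "('b, 'n) precat"
    and F :: "('b, 'n, 'a, 'm) func" and G :: "('a, 'm, 'b, 'n) func"
    and F' :: "('a, 'm, 'b, 'n) func" and G' :: "('b, 'n, 'a, 'm) func"
    and \<eta> :: "'a \<Rightarrow> 'm" and \<rho> :: "'b \<Rightarrow> 'n"
  assumes "smallness_cardinal \<kappa>"
    and "grothendieck_category \<kappa> A" and "grothendieck_category \<kappa> B"
    and "right_wide_morita_context A B F G \<eta> \<rho>"
    and "is_right_adjoint B A F F'" and "is_right_adjoint A B G G'"
  shows "equivalent_via
    (quotient_category A (localizing_closure \<kappa> A (annihilated A \<eta>)))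
    (quotient_category B (localizing_closure \<kappa> B (annihilated B \<rho>))) F' G'"
proof -
  interpret W: wide_morita_adjoints \<kappa> A B F G F' G' \<eta> \<rho> using assms by unfold_locales
  \<comment> \<open>The swapped context supplies the other natural isomorphism and shows that
    \<open>G'\<close> preserves closed objects.\<close>
  interpret S: wide_morita_adjoints \<kappa> B A G F G' F' \<rho> \<eta> by (rule W.swap)
  show ?thesis
    unfolding equivalent_via_def
    using W.quotient_unit_isomorphic S.quotient_unit_isomorphic
      additive_functor_quotient_category[OF W.additive_F' W.F'_closed]
      additive_functor_quotient_category[OF S.additive_F' S.F'_closed]
    by blast
qed

end
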